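(* The set $\mathcal{I}$ of functions $f=u+iv\in\mathcal{H}_n$ (with $u=\operatorname{Re}f$, $v=\operatorname{Im}f$ real spherical harmonics) such that $N_u\cap N_v$ is infinite is closed and nowhere dense in $\mathcal{H}_n$.
   Context: $\mathcal{H}_n$ is the finite-dimensional space (with its usual topology) of complex-valued harmonic homogeneous polynomials of degree $n$ on $\mathbb{R}^3$, also viewed as functions on the unit sphere $\mathbb{S}^2\subset\mathbb{R}^3$. For real $u\in\mathcal{H}_n$ (real-valued on $\mathbb{R}^3$), $N_u=\{x\in\mathbb{S}^2:u(x)=0\}$. *)

theory Defs
  imports "HOL-Analysis.Analysis"
begin

definition homogeneous_polynomial :: "nat \<Rightarrow> (real^3 \<Rightarrow> complex) \<Rightarrow> bool" where
  "homogeneous_polynomial n f \<longleftrightarrow>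
     (\<exists>c :: (3 \<Rightarrow> nat) \<Rightarrow> complex.
        \<forall>x. f x = (\<Sum>\<alpha> | (\<Sum>i\<in>UNIV. \<alpha> i) = n. c \<alpha> * of_real (\<Prod>i\<in>UNIV. x $ i ^ \<alpha> i)))"

definition partial_deriv :: "3 \<Rightarrow> (real^3 \<Rightarrow> complex) \<Rightarrow> real^3 \<Rightarrow> complex" where
  "partial_deriv i f x = vector_derivative (\<lambda>t. f (x + t *\<^sub>R axis i 1)) (at 0)"

definition laplacian :: "(real^3 \<Rightarrow> complex) \<Rightarrow> real^3 \<Rightarrow> complex" where
  "laplacian f x = (\<Sum>i\<in>UNIV. partial_deriv i (partial_deriv i f) x)"

definition harmonics :: "nat \<Rightarrow> (real^3 \<Rightarrow> complex) set" where
  "harmonics n = {f. homogeneous_polynomial n f \<and> (\<forall>x. laplacian f x = 0)}"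

text \<open>
  The usual topology of the finite-dimensional space of harmonics is the one induced by any norm;
  we use the supremum norm over the unit sphere. The value outside the space is a dummy, needed
  because \<^locale>\<open>Metric_space\<close> asks for nonnegativity on the whole type.
\<close>

definition harmonics_dist :: "nat \<Rightarrow> (real^3 \<Rightarrow> complex) \<Rightarrow> (real^3 \<Rightarrow> complex) \<Rightarrow> real" where
  "harmonics_dist n f g =
     (if f \<in> harmonics n \<and> g \<in> harmonics n then SUP x\<in>sphere 0 1. norm (f x - g x) else 0)"

definition harmonics_topology :: "nat \<Rightarrow> (real^3 \<Rightarrow> complex) topology" where
  "harmonics_topology n = Metric_space.mtopology (harmonics n) (harmonics_dist n)"

definition nowhere_dense_in :: "'a topology \<Rightarrow> 'a set \<Rightarrow> bool" where
  "nowhere_dense_in X S \<longleftrightarrow> S \<subseteq> topspace X \<and> X interior_of (X closure_of S) = {}"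

definition nodal_set :: "(real^3 \<Rightarrow> real) \<Rightarrow> (real^3) set" where
  "nodal_set u = {x \<in> sphere 0 1. u x = 0}"

definition infinite_common_nodal_set :: "nat \<Rightarrow> (real^3 \<Rightarrow> complex) set" where
  "infinite_common_nodal_set n =
     {f \<in> harmonics n. infinite (nodal_set (\<lambda>x. Re (f x)) \<inter> nodal_set (\<lambda>x. Im (f x)))}"


lemma finite_multi_indices: "finite {\<alpha> :: 3 \<Rightarrow> nat. (\<Sum>i\<in>UNIV. \<alpha> i) = n}"
proof (rule finite_subset)
  show "{\<alpha> :: 3 \<Rightarrow> nat. (\<Sum>i\<in>UNIV. \<alpha> i) = n} \<subseteq> PiE UNIV (\<lambda>_. {..n})"
    by (auto simp: PiE_def member_le_sum)
  show "finite (PiE (UNIV :: 3 set) (\<lambda>_. {..n}))"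
    by (intro finite_PiE) auto
qed

lemma homogeneous_polynomial_scale:
  assumes "homogeneous_polynomial n f"
  shows "f (r *\<^sub>R x) = of_real (r ^ n) * f x"
proof -
  obtain c where c: "\<And>x. f x = (\<Sum>\<alpha> | (\<Sum>i\<in>UNIV. \<alpha> i) = n.
      c \<alpha> * of_real (\<Prod>i\<in>UNIV. x $ i ^ \<alpha> i))"
    using assms unfolding homogeneous_polynomial_def by (elim exE) (rule that, erule spec)
  have "(\<Prod>i\<in>UNIV. (r *\<^sub>R x) $ i ^ \<alpha> i) = r ^ n * (\<Prod>i\<in>UNIV. x $ i ^ \<alpha> i)"
    if "(\<Sum>i\<in>UNIV. \<alpha> i) = n" for \<alpha> :: "3 \<Rightarrow> nat"
    unfolding that[symmetric] power_sum
    by (simp add: power_mult_distrib prod.distrib)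
  then have "f (r *\<^sub>R x) = (\<Sum>\<alpha> | (\<Sum>i\<in>UNIV. \<alpha> i) = n.
      c \<alpha> * of_real (r ^ n * (\<Prod>i\<in>UNIV. x $ i ^ \<alpha> i)))"
    unfolding c by (intro sum.cong refl) (simp only: mem_Collect_eq)
  also have "\<dots> = of_real (r ^ n) * f x"
    unfolding c sum_distrib_left by (intro sum.cong refl) (simp only: of_real_mult mult_ac)
  finally show ?thesis .
qed

lemma homogeneous_polynomial_continuous:
  assumes "homogeneous_polynomial n f"
  shows "continuous_on S f"
proof -
  obtain c where c: "\<And>x. f x = (\<Sum>\<alpha> | (\<Sum>i\<in>UNIV. \<alpha> i) = n.
      c \<alpha> * of_real (\<Prod>i\<in>UNIV. x $ i ^ \<alpha> i))"
    using assms unfolding homogeneous_polynomial_def by (elim exE) (rule that, erule spec)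
  have "f = (\<lambda>x. \<Sum>\<alpha> | (\<Sum>i\<in>UNIV. \<alpha> i) = n. c \<alpha> * of_real (\<Prod>i\<in>UNIV. x $ i ^ \<alpha> i))"
    using c by auto
  then show ?thesis by (simp only:) (intro continuous_intros)
qed

lemma homogeneous_polynomial_eqI:
  assumes "homogeneous_polynomial n f" "homogeneous_polynomial n g"
    and "\<And>x. x \<in> sphere 0 1 \<Longrightarrow> f x = g x"
  shows "f = g"
proof
  fix x :: "real^3"
  define y :: "real^3" where "y = (if x = 0 then axis 1 1 else x /\<^sub>R norm x)"
  have "y \<in> sphere 0 1" and x: "x = norm x *\<^sub>R y"
    by (auto simp: y_def)
  then have "f y = g y" using assms(3) by blast
  then have "f (norm x *\<^sub>R y) = g (norm x *\<^sub>R y)"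
    by (simp only: homogeneous_polynomial_scale[OF assms(1)] homogeneous_polynomial_scale[OF assms(2)])
  then show "f x = g x"
    by (simp only: x[symmetric])
qed

lemma Metric_space_harmonics: "Metric_space (harmonics n) (harmonics_dist n)"
proof -
  have ne: "sphere (0 :: real^3) 1 \<noteq> {}"
    by simp
  have bdd: "bdd_above ((\<lambda>x. norm (f x - g x)) ` sphere 0 1)"
    if "f \<in> harmonics n" "g \<in> harmonics n" for f g
    using that unfolding harmonics_def
    by (intro bounded_imp_bdd_above compact_imp_bounded compact_continuous_image
        continuous_intros homogeneous_polynomial_continuous[of n]) auto
  have le: "norm (f x - g x) \<le> harmonics_dist n f g"
    if "f \<in> harmonics n" "g \<in> harmonics n" "x \<in> sphere 0 1" for f g x
    using cSUP_upper[OF that(3) bdd[OF that(1,2)]] that by (simp add: harmonics_dist_def)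
  have pt: "axis 1 1 \<in> sphere (0 :: real^3) 1"
    by simp
  show ?thesis
  proof
    fix f g
    show "0 \<le> harmonics_dist n f g"
    proof (cases "f \<in> harmonics n \<and> g \<in> harmonics n")
      case True
      then show ?thesis using le[OF _ _ pt] norm_ge_zero order_trans by blast
    qed (auto simp: harmonics_dist_def)
    show "harmonics_dist n f g = harmonics_dist n g f"
      by (auto simp: harmonics_dist_def norm_minus_commute)
  next
    fix f g
    assume fg: "f \<in> harmonics n" "g \<in> harmonics n"
    show "harmonics_dist n f g = 0 \<longleftrightarrow> f = g"
    proof
      assume "harmonics_dist n f g = 0"
      then have "f x = g x" if "x \<in> sphere 0 1" for x
        using le[OF fg that] by simp
      then show "f = g"
        using fg homogeneous_polynomial_eqI unfolding harmonics_def by blast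
    next
      assume "f = g"
      then show "harmonics_dist n f g = 0"
        using ne by (simp add: harmonics_dist_def)
    qed
  next
    fix f g h
    assume fgh: "f \<in> harmonics n" "g \<in> harmonics n" "h \<in> harmonics n"
    have "norm (f x - h x) \<le> harmonics_dist n f g + harmonics_dist n g h"
      if "x \<in> sphere 0 1" for x
      using le[OF fgh(1,2) that] le[OF fgh(2,3) that] norm_triangle_ineq[of "f x - g x" "g x - h x"]
      by simp
    then have "(SUP x\<in>sphere 0 1. norm (f x - h x)) \<le> harmonics_dist n f g + harmonics_dist n g h"
      by (intro cSUP_least ne)
    then show "harmonics_dist n f h \<le> harmonics_dist n f g + harmonics_dist n g h"
      using fgh by (simp add: harmonics_dist_def)
  qed
qed

end

theory Submission
  imports Defs "HOL-Computational_Algebra.Field_as_Ring" "HOL-Computational_Algebra.Polynomial_Factorial"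
begin

text \<open>
  Inverse stereographic projection from a pole \<open>c\<close> turns \<open>f = u + iv\<close> into a pair of real polynomials
  in two variables. If \<open>u\<close> and \<open>v\<close> have infinitely many common zeros, elimination yields a common
  prime factor \<open>h\<close> with infinitely many zeros; \<open>h\<close> has a simple zero and hence changes sign.

  Closedness: let \<open>f\<close> have finitely many zeros, none of them at \<open>c\<close>, and let \<open>g\<close> be close to \<open>f\<close>.
  The zeros of \<open>g\<close> lie in small disjoint discs around those of \<open>f\<close>. The complement of these discs
  is connected, so if \<open>g\<close> had infinitely many zeros, then \<open>\<plusminus>h < 0\<close> would hold only inside
  the discs, with \<open>g = 0\<close> where \<open>h = 0\<close>. On a small cone a maximum principle for \<open>\<bar>g\<bar>\<^sup>2\<close> against
  a strictly superharmonic function of the same degree of homogeneity forces \<open>g = 0\<close> there, so \<open>g = 0\<close>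
  everywhere, which is absurd.

  Empty interior: perturb \<open>f\<close> by small multiples of \<open>(x + iy)\<^sup>n\<close>, which has finitely many zeros on
  the sphere. The prime factors \<open>h\<close> for different bad real parameters are distinct, and all divide
  one nonzero polynomial.
\<close>

section \<open>Bivariate real polynomials\<close>

text \<open>A polynomial in \<open>t\<close> with coefficients in the polynomials in
  \<open>s\<close>. Thus \<open>degree\<close> and \<open>pderiv\<close> refer to \<open>t\<close>,
  and a constant outer polynomial involves only \<open>s\<close>.\<close>

definition poly2 :: "real poly poly \<Rightarrow> real \<Rightarrow> real \<Rightarrow> real" where
  "poly2 p s t = poly (poly p [:t:]) s"

lemma poly2_simps [simp]:
  "poly2 (p + q) s t = poly2 p s t + poly2 q s t"
  "poly2 (p - q) s t = poly2 p s t - poly2 q s t"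
  "poly2 (p * q) s t = poly2 p s t * poly2 q s t"
  "poly2 0 s t = 0" "poly2 1 s t = 1"
  "poly2 [:c:] s t = poly c s"
  "poly2 (pCons c p) s t = poly c s + t * poly2 p s t"
  by (simp_all add: poly2_def)

lemma poly2_eq_poly_map_poly: "poly2 p s t = poly (map_poly (\<lambda>c. poly c s) p) t"
  by (induction p) (auto simp: map_poly_pCons)

lemma poly2_continuous [continuous_intros]:
  assumes "continuous_on A f" "continuous_on A g"
  shows "continuous_on A (\<lambda>x. poly2 p (f x) (g x))"
proof (induction p)
  case (pCons c p)
  then show ?case using assms by (auto intro!: continuous_intros)
qed auto

text \<open>Finiteness of roots is applied twice: in \<open>t\<close> for fixed \<open>s\<close>,
  which kills every coefficient at \<open>s\<close>, then to each coefficient.\<close>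

lemma poly2_eq_0_on_box:
  assumes "infinite A" "infinite B" "\<And>s t. s \<in> A \<Longrightarrow> t \<in> B \<Longrightarrow> poly2 p s t = 0"
  shows "p = 0"
proof -
  have *: "r = 0" if "infinite C" "\<And>x. x \<in> C \<Longrightarrow> poly r x = 0" for C and r :: "real poly"
    using that poly_roots_finite[of r] finite_subset[of C "{x. poly r x = 0}"] by blast
  have "map_poly (\<lambda>c. poly c s) p = 0" if "s \<in> A" for s
    using *[OF assms(2)] assms(3)[OF that] by (simp add: poly2_eq_poly_map_poly)
  then have "poly (coeff p i) s = 0" if "s \<in> A" for s i
    using that by (metis coeff_0 coeff_map_poly poly_0)
  then have "coeff p i = 0" for i
    using *[OF assms(1)] by blast
  then show ?thesis by (simp add: poly_eq_iff)
qed

text \<open>\<open>map_poly\<close> restricts \<open>p\<close> to a vertical line. If the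
  restriction is zero, \<open>s\<close> is a root of every coefficient, so the linear factor comes
  out of all of them.\<close>

lemma vertical_line_dvd:
  fixes p :: "real poly poly"
  assumes "map_poly (\<lambda>c. poly c s) p = 0"
  shows "[:[:-s, 1:]:] dvd p"
proof -
  have "poly (coeff p i) s = 0" for i
    using assms by (metis coeff_0 coeff_map_poly poly_0)
  then show ?thesis
    by (auto simp: const_poly_dvd_iff poly_eq_0_iff_dvd)
qed

text \<open>Minimality of the degree in the ideal generated by \<open>h\<close> and \<open>q\<close> replaces the resultant.\<close>
lemma prime_not_dvd_elimination:
  fixes h q :: "'a :: factorial_ring_gcd poly"
  assumes "prime h" "\<not> h dvd q"
  obtains a b d where "d \<noteq> 0" "a * h + b * q = [:d:]"
proof (cases "degree h = 0")
  case True
  then obtain d where "h = [:d:]" by (rule degree_eq_zeroE)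
  then have "d \<noteq> 0" "1 * h + 0 * q = [:d:]" using assms(1) by auto
  then show thesis using that by blast
next
  case False
  define J where "J = {r. r \<noteq> 0 \<and> (\<exists>a b. r = a * h + b * q)}"
  have "h \<noteq> 0" using False by auto
  moreover have "h = 1 * h + 0 * q" by simp
  ultimately have "h \<in> J" unfolding J_def by blast
  then obtain r where r: "r \<in> J" and min: "\<And>r'. r' \<in> J \<Longrightarrow> degree r \<le> degree r'"
    using ex_has_least_nat[of "\<lambda>r. r \<in> J" h degree] by blast
  obtain a b where ab: "r = a * h + b * q" and "r \<noteq> 0" using r by (auto simp: J_def)
  \<comment> \<open>Leading coefficients need not be invertible, hence pseudo-division. The
    remainder stays in the ideal, so minimality of \<open>degree r\<close> makes it zero: up to a
    nonzero constant factor, \<open>r\<close> divides every element of the ideal.\<close>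
  have reduce: "\<exists>c e. c \<noteq> 0 \<and> smult c f = r * e" if f: "f = a' * h + b' * q" for f a' b'
  proof -
    obtain e r' where er: "pseudo_divmod f r = (e, r')" by fastforce
    define c where "c = coeff r (degree r) ^ (Suc (degree f) - degree r)"
    have eq: "smult c f = r * e + r'" and deg: "r' = 0 \<or> degree r' < degree r"
      using pseudo_divmod[OF \<open>r \<noteq> 0\<close> er] by (auto simp: c_def)
    have "r' = smult c f - r * e" using eq by simp
    also have "\<dots> = (smult c a' - a * e) * h + (smult c b' - b * e) * q"
      by (simp add: f ab algebra_simps smult_add_right)
    finally have "r' \<in> J" if "r' \<noteq> 0" using that unfolding J_def by blast
    then have "r' = 0" using deg min[of r'] by fastforce
    moreover have "c \<noteq> 0" using \<open>r \<noteq> 0\<close> by (simp add: c_def)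
    ultimately show ?thesis using eq by auto
  qed
  obtain c e where ce: "c \<noteq> 0" "smult c h = r * e" using reduce[of h 1 0] by auto
  obtain c' e' where ce': "c' \<noteq> 0" "smult c' q = r * e'" using reduce[of q 0 1] by auto
  have "degree r = 0"
  proof -
    \<comment> \<open>The prime \<open>h\<close> divides \<open>r\<close> or the cofactor
      \<open>e\<close>. The first would make \<open>h\<close> divide \<open>q\<close>; in the second
      case \<open>h\<close> cancels and \<open>r\<close> divides a nonzero constant.\<close>
    have "h dvd r * e" using ce(2) by (metis dvd_smult dvd_refl)
    then consider "h dvd r" | "h dvd e" using assms(1) by (auto simp: prime_dvd_mult_iff)
    then show ?thesis
    proof cases
      case 1
      then have "h dvd [:c':] * q" using ce'(2) by simp
      moreover have "\<not> h dvd [:c':]"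
        using False ce'(1) dvd_imp_degree_le[of h "[:c':]"] by auto
      ultimately show ?thesis using assms prime_dvd_multD by blast
    next
      case 2
      then obtain e2 where "e = h * e2" by blast
      then have "h * [:c:] = h * (r * e2)" using ce(2) by (simp add: mult_ac)
      then have "[:c:] = r * e2" using \<open>h \<noteq> 0\<close> mult_left_cancel by blast
      then have "r dvd [:c:]" by simp
      then show ?thesis using ce(1) dvd_imp_degree_le[of r "[:c:]"] by auto
    qed
  qed
  then obtain d where d: "r = [:d:]" by (rule degree_eq_zeroE)
  show thesis by (rule that[of d a b]) (use d ab \<open>r \<noteq> 0\<close> in auto)
qed

text \<open>The eliminant \<open>d\<close> involves only \<open>s\<close>, so it confines the common
  zeros to finitely many vertical lines. On each line \<open>h\<close> or \<open>q\<close> is a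
  nonzero polynomial in \<open>t\<close>.\<close>

lemma finite_common_zeros_prime:
  assumes "prime h" "\<not> h dvd q"
  shows "finite {(s, t). poly2 h s t = 0 \<and> poly2 q s t = 0}"
proof -
  obtain a b d where d: "d \<noteq> 0" "a * h + b * q = [:d:]"
    by (rule prime_not_dvd_elimination[OF assms])
  have root: "poly d s = 0" if "poly2 h s t = 0" "poly2 q s t = 0" for s t
    using arg_cong[OF d(2), of "\<lambda>r. poly2 r s t"] that by simp
  have fibre: "finite {t. poly2 h s t = 0 \<and> poly2 q s t = 0}" for s
  proof (cases "map_poly (\<lambda>c. poly c s) h = 0")
    case False
    then show ?thesis
      using poly_roots_finite[OF False] by (simp add: poly2_eq_poly_map_poly)
  next
    case True
    then obtain k where k: "h = [:[:-s, 1:]:] * k" using vertical_line_dvd by blast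
    have "irreducible h" using assms(1) by (simp add: prime_imp_prime_elem prime_elem_imp_irreducible)
    then have "[:[:-s, 1:]:] dvd 1 \<or> k dvd 1" using k irreducibleD by blast
    moreover have "\<not> [:[:-s, 1:]:] dvd 1"
      by (simp add: is_unit_const_poly_iff is_unit_poly_iff)
    \<comment> \<open>Here \<open>h\<close> vanishes on the line and, being irreducible, is the
      linear factor up to a unit; if \<open>q\<close> vanished there too, \<open>h\<close> would
      divide it.\<close>
    ultimately have "h dvd [:[:-s, 1:]:]" by (metis k mult_unit_dvd_iff dvd_refl)
    then have "map_poly (\<lambda>c. poly c s) q \<noteq> 0"
      using vertical_line_dvd assms(2) dvd_trans by blast
    then show ?thesis
      using poly_roots_finite[of "map_poly (\<lambda>c. poly c s) q"] by (simp add: poly2_eq_poly_map_poly)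
  qed
  have "{(s, t). poly2 h s t = 0 \<and> poly2 q s t = 0} \<subseteq>
        Sigma {s. poly d s = 0} (\<lambda>s. {t. poly2 h s t = 0 \<and> poly2 q s t = 0})"
    using root by auto
  then show ?thesis
    by (rule finite_subset) (auto intro!: finite_SigmaI fibre poly_roots_finite d(1))
qed

text \<open>\<open>pderiv h\<close> has smaller degree, so \<open>h\<close> does not divide it and
  they share only finitely many zeros. At one of the remaining zeros the \<open>t\<close>-derivative
  is nonzero and \<open>h\<close> changes sign. If \<open>h\<close> does not involve
  \<open>t\<close>, it is a linear factor in \<open>s\<close> up to a constant.\<close>

lemma prime_infinite_zeros_sign_change:
  assumes "prime h" "infinite {(s, t). poly2 h s t = 0}"
  shows "(\<exists>s t. poly2 h s t < 0) \<and> (\<exists>s t. poly2 h s t > 0)"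
proof (cases "degree h = 0")
  case True
  then obtain g where g: "h = [:g:]" by (rule degree_eq_zeroE)
  have "\<exists>s. poly g s = 0"
  proof (rule ccontr)
    assume "\<nexists>s. poly g s = 0"
    then have "{(s, t). poly2 h s t = 0} = {}" by (auto simp: g)
    then show False using assms(2) by simp
  qed
  then obtain s0 where "poly g s0 = 0" by blast
  then obtain k where k: "g = [:-s0, 1:] * k" by (auto simp: poly_eq_0_iff_dvd)
  then have hk: "h = [:[:-s0, 1:]:] * [:k:]" by (simp add: g)
  have "irreducible h" using assms(1) by (simp add: prime_imp_prime_elem prime_elem_imp_irreducible)
  then have "[:[:-s0, 1:]:] dvd 1 \<or> [:k:] dvd 1" using hk irreducibleD by blast
  then have "k dvd 1"
    by (auto simp: is_unit_const_poly_iff is_unit_poly_iff)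
  then obtain c where c: "k = [:c:]" "c \<noteq> 0" by (metis is_unit_poly_iff not_is_unit_0)
  have ev: "poly2 h s t = (s - s0) * c" for s t
    by (simp add: g k c algebra_simps)
  \<comment> \<open>The two values are plus and minus the square of \<open>c\<close>, so the sign of
    \<open>c\<close> is irrelevant.\<close>
  have "poly2 h (s0 + c) 0 > 0" "poly2 h (s0 - c) 0 < 0"
    using c(2) by (auto simp: ev) (auto simp: zero_less_mult_iff)
  then show ?thesis by blast
next
  case False
  then have "pderiv h \<noteq> 0" "degree (pderiv h) < degree h"
    by (auto simp: pderiv_eq_0_iff degree_pderiv)
  then have "\<not> h dvd pderiv h" using dvd_imp_degree_le by fastforce
  then have fin: "finite {(s, t). poly2 h s t = 0 \<and> poly2 (pderiv h) s t = 0}"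
    by (rule finite_common_zeros_prime[OF assms(1)])
  have "\<exists>s t. poly2 h s t = 0 \<and> poly2 (pderiv h) s t \<noteq> 0"
  proof (rule ccontr)
    assume "\<not> ?thesis"
    then have "{(s, t). poly2 h s t = 0} \<subseteq> {(s, t). poly2 h s t = 0 \<and> poly2 (pderiv h) s t = 0}"
      by blast
    then show False using fin assms(2) finite_subset by blast
  qed
  then obtain s t where st: "poly2 h s t = 0" "poly2 (pderiv h) s t \<noteq> 0" by blast
  define r where "r = map_poly (\<lambda>c. poly c s) h"
  have r: "poly2 h s x = poly r x" for x by (simp add: r_def poly2_eq_poly_map_poly)
  have "pderiv r = map_poly (\<lambda>c. poly c s) (pderiv h)"
    by (intro poly_eqI) (simp add: r_def coeff_map_poly coeff_pderiv)
  then have nz: "poly (pderiv r) t \<noteq> 0" using st(2) by (simp add: poly2_eq_poly_map_poly)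
  have D: "((poly r) has_real_derivative poly (pderiv r) t) (at t)"
    by (rule poly_DERIV)
  obtain d e where de: "d > 0" "e > 0"
      and lr: "\<And>x. 0 < x \<Longrightarrow> x < d \<Longrightarrow> x < e \<Longrightarrow> poly r (t - x) * poly r (t + x) < 0"
  proof (cases "poly (pderiv r) t > 0")
    case True
    obtain d e where "d > 0" "e > 0" "\<forall>x>0. x < d \<longrightarrow> poly r (t - x) < poly r t"
        "\<forall>x>0. x < e \<longrightarrow> poly r t < poly r (t + x)"
      using DERIV_pos_inc_left[OF D True] DERIV_pos_inc_right[OF D True] by blast
    then show ?thesis using that[of d e] st(1) by (simp add: r mult_less_0_iff)
  next
    case False
    then have neg: "poly (pderiv r) t < 0" using nz by simp
    obtain d e where "d > 0" "e > 0" "\<forall>x>0. x < d \<longrightarrow> poly r t < poly r (t - x)"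
        "\<forall>x>0. x < e \<longrightarrow> poly r (t + x) < poly r t"
      using DERIV_neg_dec_left[OF D neg] DERIV_neg_dec_right[OF D neg] by blast
    then show ?thesis using that[of d e] st(1) by (simp add: r mult_less_0_iff)
  qed
  have "poly r (t - min d e / 2) * poly r (t + min d e / 2) < 0"
    using de by (intro lr) auto
  then show ?thesis unfolding r[symmetric] mult_less_0_iff by blast
qed

text \<open>By pigeonhole, one of the finitely many prime factors of a nonzero member of the pair
  shares infinitely many zeros with the other member, and so divides it.\<close>

lemma infinite_common_zeros_prime_divisor:
  assumes inf: "infinite {(s, t). poly2 p s t = 0 \<and> poly2 q s t = 0}" and "p \<noteq> 0 \<or> q \<noteq> 0"
  shows "\<exists>h. prime h \<and> h dvd p \<and> h dvd q \<and> infinite {(s, t). poly2 h s t = 0}"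
proof -
  have *: "\<exists>h. prime h \<and> h dvd p \<and> h dvd q \<and> infinite {(s, t). poly2 h s t = 0}"
    if nz: "p \<noteq> 0" and inf: "infinite {(s, t). poly2 p s t = 0 \<and> poly2 q s t = 0}" for p q
  proof -
    let ?Z = "\<lambda>h. {(s, t). poly2 h s t = 0 \<and> poly2 q s t = 0}"
    have "\<exists>h\<in>prime_factors p. poly2 h s t = 0" if "poly2 p s t = 0" for s t
    proof -
      have "p dvd prod_mset (prime_factorization p)"
        using prod_mset_prime_factorization_weak[OF nz] by (rule associatedD2)
      then have "poly2 (prod_mset (prime_factorization p)) s t = 0"
        using that by (auto elim!: dvdE)
      moreover have "\<exists>h\<in>#M. poly2 h s t = 0" if "poly2 (prod_mset M) s t = 0" for M
        using that by (induction M) auto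
      ultimately show ?thesis by blast
    qed
    then have "?Z p \<subseteq> (\<Union>h\<in>prime_factors p. ?Z h)" by auto
    then obtain h where h: "h \<in> prime_factors p" "infinite (?Z h)"
      using inf by (meson finite_UN_I finite_set_mset finite_subset)
    then have "prime h" "h dvd p" by (auto simp: in_prime_factors_iff)
    moreover have "h dvd q" using finite_common_zeros_prime \<open>prime h\<close> h(2) by blast
    moreover have "infinite {(s, t). poly2 h s t = 0}"
      using h(2) finite_subset[of "?Z h" "{(s, t). poly2 h s t = 0}"] by blast
    ultimately show ?thesis by blast
  qed
  have "{(s, t). poly2 q s t = 0 \<and> poly2 p s t = 0} = {(s, t). poly2 p s t = 0 \<and> poly2 q s t = 0}"
    by auto
  then show ?thesis using assms *[of p q] *[of q p] by metis
qed

section \<open>A maximum principle for harmonic polynomials\<close>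

lemma homogeneous_polynomial_polynomial_function:
  assumes "homogeneous_polynomial n f"
  shows "polynomial_function f"
proof -
  obtain c where c: "\<And>x. f x = (\<Sum>\<alpha> | (\<Sum>i\<in>UNIV. \<alpha> i) = n.
      c \<alpha> * of_real (\<Prod>i\<in>UNIV. x $ i ^ \<alpha> i))"
    using assms unfolding homogeneous_polynomial_def by (elim exE) (rule that, erule spec)
  have "polynomial_function (\<lambda>x :: real^3. (\<Prod>i\<in>UNIV. x $ i ^ \<alpha> i) *\<^sub>R c \<alpha>)" for \<alpha> :: "3 \<Rightarrow> nat"
    by (intro polynomial_function_mult polynomial_function_const)
       (simp only: flip: real_polynomial_function_eq,
        intro real_polynomial_function_prod real_polynomial_function_power
          real_polynomial_function.intros(1) bounded_linear_vec_nth finite)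
  then have "polynomial_function (\<lambda>x. \<Sum>\<alpha> | (\<Sum>i\<in>UNIV. \<alpha> i) = n. (\<Prod>i\<in>UNIV. x $ i ^ \<alpha> i) *\<^sub>R c \<alpha>)"
    by (intro polynomial_function_sum finite_multi_indices)
  also have "(\<lambda>x. \<Sum>\<alpha> | (\<Sum>i\<in>UNIV. \<alpha> i) = n. (\<Prod>i\<in>UNIV. x $ i ^ \<alpha> i) *\<^sub>R c \<alpha>) = f"
    unfolding fun_eq_iff c by (intro allI sum.cong refl) (simp only: scaleR_conv_of_real mult.commute)
  finally show ?thesis .
qed

lemma partial_deriv_eqI:
  assumes "((\<lambda>s. f (x + s *\<^sub>R axis i 1)) has_vector_derivative d) (at t)"
  shows "partial_deriv i f (x + t *\<^sub>R axis i 1) = d"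
proof -
  have "((+) t has_vector_derivative 1) (at 0)"
    by (auto intro!: derivative_eq_intros)
  then have "((\<lambda>s. f (x + s *\<^sub>R axis i 1)) \<circ> (+) t has_vector_derivative 1 *\<^sub>R d) (at 0)"
    using assms by (intro vector_diff_chain_at) auto
  then show ?thesis
    unfolding partial_deriv_def by (intro vector_derivative_at) (simp add: o_def algebra_simps)
qed

text \<open>\<open>partial_deriv\<close> is total, so existence has to be shown: on a line a
  polynomial function is polynomial in the parameter, and so is its derivative. All \<open>t\<close>
  are covered so that one-variable calculus applies along the line.\<close>

lemma partial_deriv_along_axis:
  fixes i :: 3 and x :: "real^3"
  assumes "polynomial_function f"
  shows "((\<lambda>s. f (x + s *\<^sub>R axis i 1)) has_vector_derivative
            partial_deriv i f (x + t *\<^sub>R axis i 1)) (at t)"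
    and "((\<lambda>s. partial_deriv i f (x + s *\<^sub>R axis i 1)) has_vector_derivative
            partial_deriv i (partial_deriv i f) (x + t *\<^sub>R axis i 1)) (at t)"
proof -
  have "polynomial_function (\<lambda>s. x + s *\<^sub>R axis i 1)"
    by (intro polynomial_function_add polynomial_function_const polynomial_function_mult polynomial_function_id)
  then have "polynomial_function (\<lambda>s. f (x + s *\<^sub>R axis i 1))"
    using polynomial_function_compose[OF _ assms] by (simp add: o_def)
  then obtain p where p: "polynomial_function p"
      "\<And>t. ((\<lambda>s. f (x + s *\<^sub>R axis i 1)) has_vector_derivative p t) (at t)"
    using has_vector_derivative_polynomial_function by blast
  obtain p' where p': "\<And>t. (p has_vector_derivative p' t) (at t)"
    using has_vector_derivative_polynomial_function p(1) by blast
  have eq: "partial_deriv i f (x + t *\<^sub>R axis i 1) = p t" for t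
    using p(2) by (rule partial_deriv_eqI)
  show "((\<lambda>s. f (x + s *\<^sub>R axis i 1)) has_vector_derivative
          partial_deriv i f (x + t *\<^sub>R axis i 1)) (at t)"
    using p(2) by (simp add: eq)
  have D: "((\<lambda>s. partial_deriv i f (x + s *\<^sub>R axis i 1)) has_vector_derivative p' t) (at t)"
    using p' by (simp add: eq)
  then show "((\<lambda>s. partial_deriv i f (x + s *\<^sub>R axis i 1)) has_vector_derivative
            partial_deriv i (partial_deriv i f) (x + t *\<^sub>R axis i 1)) (at t)"
    using partial_deriv_eqI[OF D] by simp
qed

lemma partial_deriv_lincomb:
  assumes "\<And>x. ((\<lambda>s. f (x + s *\<^sub>R axis i 1)) has_vector_derivative f' x) (at 0)"
      and "\<And>x. ((\<lambda>s. g (x + s *\<^sub>R axis i 1)) has_vector_derivative g' x) (at 0)"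
  shows "partial_deriv i (\<lambda>x. f x + c * g x) = (\<lambda>x. f' x + c * g' x)"
proof
  fix x
  have "((\<lambda>s. f (x + s *\<^sub>R axis i 1) + c * g (x + s *\<^sub>R axis i 1)) has_vector_derivative f' x + c * g' x) (at 0)"
    using assms by (auto intro!: derivative_eq_intros)
  from partial_deriv_eqI[of "\<lambda>x. f x + c * g x", OF this]
  show "partial_deriv i (\<lambda>x. f x + c * g x) x = f' x + c * g' x" by simp
qed

lemma laplacian_lincomb:
  assumes "polynomial_function f" "polynomial_function g"
  shows "laplacian (\<lambda>x. f x + c * g x) x = laplacian f x + c * laplacian g x"
proof -
  have "partial_deriv i (\<lambda>x. f x + c * g x) = (\<lambda>x. partial_deriv i f x + c * partial_deriv i g x)" for i
    using partial_deriv_along_axis(1)[where i = i and t = 0] assms by (intro partial_deriv_lincomb) simp_all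
  moreover have "partial_deriv i (\<lambda>x. partial_deriv i f x + c * partial_deriv i g x) =
      (\<lambda>x. partial_deriv i (partial_deriv i f) x + c * partial_deriv i (partial_deriv i g) x)" for i
    using partial_deriv_along_axis(2)[where i = i and t = 0] assms by (intro partial_deriv_lincomb) simp_all
  ultimately show ?thesis
    by (simp add: laplacian_def sum.distrib sum_distrib_left)
qed

section \<open>Comparison at a touching point\<close>

lemma second_derivative_local_max:
  fixes g g' :: "real \<Rightarrow> real"
  assumes g: "\<And>t. (g has_real_derivative g' t) (at t)"
    and g': "(g' has_real_derivative d) (at 0)"
    and e: "e > 0" "\<And>t. \<bar>t\<bar> < e \<Longrightarrow> g t \<le> g 0"
  shows "d \<le> 0"
proof (rule ccontr)
  assume "\<not> d \<le> 0"
  then have "d > 0" by simp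
  have "g' 0 = 0"
    by (rule DERIV_local_max[OF g e(1)]) (use e(2) in auto)
  then obtain b where b: "b > 0" "\<And>h. 0 < h \<Longrightarrow> h < b \<Longrightarrow> g' h > 0"
    using DERIV_pos_inc_right[OF g' \<open>d > 0\<close>] by auto
  define h where "h = min b e / 2"
  have h: "0 < h" "h < b" "h < e" using b(1) e(1) by (auto simp: h_def)
  obtain z where z: "0 < z" "z < h" "g h - g 0 = (h - 0) * g' z"
    using MVT2[OF h(1), of g g'] g by blast
  then have "g h > g 0"
    using b(2)[of z] h by (smt (verit) mult_pos_pos)
  then show False using e(2)[of h] h by simp
qed

text \<open>The squared modulus of a harmonic function is subharmonic, while \<open>\<phi>\<close>
  has negative Laplacian at \<open>q\<close>. Their difference would have a local maximum at
  \<open>q\<close>, with nonpositive second derivatives along the axes but positive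
  Laplacian.\<close>

lemma harmonic_norm_le_barrier_contradiction:
  fixes f :: "real^3 \<Rightarrow> complex" and \<phi> :: "real^3 \<Rightarrow> real"
  assumes f: "polynomial_function f" "laplacian f q = 0" and "M > 0"
    and \<phi>: "\<And>i t. ((\<lambda>s. \<phi> (q + s *\<^sub>R axis i 1)) has_real_derivative \<phi>' i t) (at t)"
    and \<phi>': "\<And>i. (\<phi>' i has_real_derivative \<phi>'' i) (at 0)"
    and neg: "(\<Sum>i\<in>UNIV. \<phi>'' i) < 0"
    and le: "\<forall>\<^sub>F x in nhds q. (cmod (f x))\<^sup>2 \<le> M * \<phi> x"
    and eq: "(cmod (f q))\<^sup>2 = M * \<phi> q"
  shows False
proof -
  define a b where "a = (\<lambda>x. Re (f x))" and "b = (\<lambda>x. Im (f x))"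
  define a1 b1 where "a1 = (\<lambda>i x. Re (partial_deriv i f x))" and "b1 = (\<lambda>i x. Im (partial_deriv i f x))"
  define a2 b2 where "a2 = (\<lambda>i. Re (partial_deriv i (partial_deriv i f) q))"
    and "b2 = (\<lambda>i. Im (partial_deriv i (partial_deriv i f) q))"
  obtain \<delta> where \<delta>: "\<delta> > 0" "\<And>x. dist x q < \<delta> \<Longrightarrow> (cmod (f x))\<^sup>2 \<le> M * \<phi> x"
    using le by (auto simp: eventually_nhds_metric)
  have *: "2 * ((a1 i q)\<^sup>2 + a q * a2 i + (b1 i q)\<^sup>2 + b q * b2 i) - M * \<phi>'' i \<le> 0" for i
  proof -
    let ?l = "\<lambda>t. q + t *\<^sub>R axis i (1 :: real)"
    note D = partial_deriv_along_axis[OF f(1), where i = i and x = q, unfolded has_vector_derivative_complex_iff]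
    have D1: "((\<lambda>t. a (?l t)) has_real_derivative a1 i (?l t)) (at t)"
      "((\<lambda>t. b (?l t)) has_real_derivative b1 i (?l t)) (at t)" for t
      using D(1)[where t = t] by (auto simp: a_def b_def a1_def b1_def)
    have D2: "((\<lambda>t. a1 i (?l t)) has_real_derivative a2 i) (at 0)"
      "((\<lambda>t. b1 i (?l t)) has_real_derivative b2 i) (at 0)"
      using D(2)[where t = 0] by (auto simp: a2_def b2_def a1_def b1_def)
    show ?thesis
    proof (rule second_derivative_local_max[OF _ _ \<delta>(1)])
      show "((\<lambda>t. (a (?l t))\<^sup>2 + (b (?l t))\<^sup>2 - M * \<phi> (?l t)) has_real_derivative
              2 * (a (?l t) * a1 i (?l t) + b (?l t) * b1 i (?l t)) - M * \<phi>' i t) (at t)" for t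
        by (rule derivative_eq_intros D1 \<phi> refl)+ (simp add: algebra_simps)
      show "((\<lambda>t. 2 * (a (?l t) * a1 i (?l t) + b (?l t) * b1 i (?l t)) - M * \<phi>' i t) has_real_derivative
              2 * ((a1 i q)\<^sup>2 + a q * a2 i + (b1 i q)\<^sup>2 + b q * b2 i) - M * \<phi>'' i) (at 0)"
        by (rule derivative_eq_intros D1 D2 \<phi>' refl)+ (simp add: algebra_simps power2_eq_square)
      fix t :: real assume "\<bar>t\<bar> < \<delta>"
      then have "dist (?l t) q < \<delta>" by (simp add: dist_norm)
      from \<delta>(2)[OF this] show "(a (?l t))\<^sup>2 + (b (?l t))\<^sup>2 - M * \<phi> (?l t) \<le> (a (?l 0))\<^sup>2 + (b (?l 0))\<^sup>2 - M * \<phi> (?l 0)"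
        using eq by (simp add: cmod_power2 a_def b_def)
    qed
  qed
  \<comment> \<open>Dropping the squared first derivatives is what subharmonicity amounts to; after
    summation, harmonicity removes the second derivatives of \<open>f\<close>.\<close>
  have "2 * (a q * a2 i + b q * b2 i) - M * \<phi>'' i \<le> 0" for i
    using *[of i] zero_le_power2[of "a1 i q"] zero_le_power2[of "b1 i q"] by (smt (verit))
  then have "(\<Sum>i\<in>UNIV. 2 * (a q * a2 i + b q * b2 i) - M * \<phi>'' i) \<le> 0"
    by (intro sum_nonpos) auto
  moreover have "(\<Sum>i\<in>UNIV. a2 i) = 0" "(\<Sum>i\<in>UNIV. b2 i) = 0"
    using f(2) by (simp_all add: laplacian_def a2_def b2_def flip: Re_sum Im_sum)
  then have "(\<Sum>i\<in>UNIV. 2 * (a q * a2 i + b q * b2 i) - M * \<phi>'' i) = - M * (\<Sum>i\<in>UNIV. \<phi>'' i)"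
    by (simp add: sum_subtractf sum.distrib flip: sum_distrib_left)
  ultimately show False using \<open>M > 0\<close> neg by (simp add: mult_le_0_iff zero_le_mult_iff)
qed

text \<open>On the ray spanned by a unit vector \<open>p\<close> the constant makes the Laplacian
  \<open>2n(2n - 1) - 4(2n)\<^sup>2 < 0\<close> times a power of the distance to the origin, where \<open>n = m + 1\<close>.\<close>
definition barrier :: "nat \<Rightarrow> real^3 \<Rightarrow> real^3 \<Rightarrow> real" where
  "barrier m p x = (1 + (2 * real m + 2)\<^sup>2) * (x \<bullet> p) ^ (2 * m + 2)
                   - (2 * real m + 2)\<^sup>2 * (x \<bullet> p) ^ (2 * m) * (x \<bullet> x)"

text \<open>The Laplacian of \<open>barrier\<close> in closed form, whose continuity is apparent;
  \<open>harmonic_le_barrier_contradiction\<close> identifies it with the sum of the axis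
  derivatives. For \<open>m = 0\<close> the truncated exponent \<open>2 * m - 2\<close> is harmless,
  since its factor \<open>2 * real m\<close> vanishes.\<close>

definition barrier_laplacian :: "nat \<Rightarrow> real^3 \<Rightarrow> real^3 \<Rightarrow> real" where
  "barrier_laplacian m p x =
     (1 + (2 * real m + 2)\<^sup>2) * (2 * real m + 2) * (2 * real m + 1) * (x \<bullet> p) ^ (2 * m) * (p \<bullet> p)
     - (2 * real m + 2)\<^sup>2 * (2 * real m * (2 * real m - 1) * (x \<bullet> p) ^ (2 * m - 2) * (x \<bullet> x) * (p \<bullet> p)
        + (8 * real m + 6) * (x \<bullet> p) ^ (2 * m))"

text \<open>The degree is that of the squared modulus of a harmonic of degree \<open>m + 1\<close>,
  so a comparison of the two at one point extends along its ray.\<close>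

lemma barrier_scale: "barrier m p (c *\<^sub>R x) = c ^ (2 * m + 2) * barrier m p x"
  by (simp add: barrier_def power_mult_distrib power_add power2_eq_square algebra_simps)

lemma barrier_on_ray:
  assumes "norm p = 1" "c > 0"
  shows "barrier m p (c *\<^sub>R p) > 0" "barrier_laplacian m p (c *\<^sub>R p) < 0"
proof -
  have [simp]: "p \<bullet> p = 1" using assms(1) by (simp add: norm_eq_1)
  show "barrier m p (c *\<^sub>R p) > 0"
    unfolding barrier_scale using assms(2) by (simp add: barrier_def)
  define A where "A = (2 * real m + 2)\<^sup>2"
  \<comment> \<open>The power identity can fail for \<open>m = 0\<close> because subtraction
    truncates; there the factor \<open>2 * real m\<close> saves the next equation.\<close>
  have "m = 0 \<or> c ^ (2 * m - 2) * c\<^sup>2 = c ^ (2 * m)"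
    by (cases m) (simp_all add: power_add power2_eq_square)
  then have E: "2 * real m * (2 * real m - 1) * (c ^ (2 * m - 2) * c\<^sup>2) = 2 * real m * (2 * real m - 1) * c ^ (2 * m)"
    by (elim disjE) (simp_all only: of_nat_0 mult_zero_left mult_zero_right)
  have S: "barrier_laplacian m p (c *\<^sub>R p) = (1 + A) * (2 * real m + 2) * (2 * real m + 1) * c ^ (2 * m)
      - A * (2 * real m * (2 * real m - 1) * (c ^ (2 * m - 2) * c\<^sup>2) + (8 * real m + 6) * c ^ (2 * m))"
    by (simp add: barrier_laplacian_def A_def power2_eq_square[of c] mult.assoc)
  \<comment> \<open>The coefficient of \<open>A\<close> collapses: \<open>(2 * m + 2) * (2 * m + 1)
    - 2 * m * (2 * m - 1) - (8 * m + 6) = -4\<close>.\<close>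
  have "barrier_laplacian m p (c *\<^sub>R p) = c ^ (2 * m) * ((2 * real m + 2) * (2 * real m + 1) - 4 * A)"
    unfolding S E by (simp add: algebra_simps)
  moreover have "(2 * real m + 2) * (2 * real m + 1) < 4 * A"
    unfolding A_def power2_eq_square by (auto simp: algebra_simps add_pos_nonneg)
  ultimately show "barrier_laplacian m p (c *\<^sub>R p) < 0"
    using assms(2) by (simp add: mult_less_0_iff)
qed

lemma barrier_continuous [continuous_intros]:
  "continuous_on S f \<Longrightarrow> continuous_on S (\<lambda>x. barrier m p (f x))"
  "continuous_on S f \<Longrightarrow> continuous_on S (\<lambda>x. barrier_laplacian m p (f x))"
  unfolding barrier_def barrier_laplacian_def by (intro continuous_intros; assumption)+

lemma harmonic_le_barrier_contradiction:
  fixes f :: "real^3 \<Rightarrow> complex"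
  assumes f: "polynomial_function f" "laplacian f q = 0" and "M > 0"
    and neg: "barrier_laplacian m p q < 0"
    and le: "\<forall>\<^sub>F x in nhds q. (cmod (f x))\<^sup>2 \<le> M * barrier m p x"
    and eq: "(cmod (f q))\<^sup>2 = M * barrier m p q"
  shows False
proof -
  define A where "A = (2 * real m + 2)\<^sup>2"
  \<comment> \<open>Along an axis line through \<open>q\<close>, the inner product with
    \<open>p\<close> is affine (\<open>l\<close>) and the squared norm is quadratic
    (\<open>r\<close>) in the parameter.\<close>
  define l where "l = (\<lambda>i t. q \<bullet> p + t * p $ i)"
  define r where "r = (\<lambda>i t. q \<bullet> q + 2 * t * q $ i + t\<^sup>2)"
  have line: "barrier m p (q + t *\<^sub>R axis i 1) = (1 + A) * l i t ^ (2 * m + 2) - A * l i t ^ (2 * m) * r i t" for i t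
    by (simp add: barrier_def A_def l_def r_def inner_simps inner_axis inner_axis' power2_eq_square algebra_simps)
  have Dl [derivative_intros]: "(l i has_real_derivative p $ i) (at t)" for i t
    unfolding l_def by (auto intro!: derivative_eq_intros)
  have Dr [derivative_intros]: "(r i has_real_derivative 2 * q $ i + 2 * t) (at t)" for i t
    unfolding r_def by (auto intro!: derivative_eq_intros)
  define d2 where "d2 = (\<lambda>i. (1 + A) * (2 * real m + 2) * (2 * real m + 1) * (p $ i)\<^sup>2 * (q \<bullet> p) ^ (2 * m)
      - A * (2 * real m * (2 * real m - 1) * (p $ i)\<^sup>2 * (q \<bullet> p) ^ (2 * m - 2) * (q \<bullet> q)
        + 8 * real m * (p $ i * q $ i) * (q \<bullet> p) ^ (2 * m - 1) + 2 * (q \<bullet> p) ^ (2 * m)))"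
  have "(\<Sum>i\<in>UNIV. d2 i) = barrier_laplacian m p q"
  proof -
    have pp: "(p $ 1)\<^sup>2 + (p $ 2)\<^sup>2 + (p $ 3)\<^sup>2 = p \<bullet> p"
      and pq: "p $ 1 * q $ 1 + p $ 2 * q $ 2 + p $ 3 * q $ 3 = q \<bullet> p"
      by (simp_all add: inner_vec_def sum_3 power2_eq_square mult.commute)
    have S: "(\<Sum>i\<in>UNIV. d2 i) = (1 + A) * (2 * real m + 2) * (2 * real m + 1) * (p \<bullet> p) * (q \<bullet> p) ^ (2 * m)
      - A * (2 * real m * (2 * real m - 1) * (p \<bullet> p) * (q \<bullet> p) ^ (2 * m - 2) * (q \<bullet> q)
        + 8 * real m * (q \<bullet> p) * (q \<bullet> p) ^ (2 * m - 1) + 6 * (q \<bullet> p) ^ (2 * m))"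
      unfolding sum_3 d2_def pp[symmetric] pq[symmetric] by (simp add: algebra_simps)
    have E: "8 * real m * (q \<bullet> p) * (q \<bullet> p) ^ (2 * m - 1) = 8 * real m * (q \<bullet> p) ^ (2 * m)"
      by (cases m) simp_all
    show ?thesis
      unfolding S E by (simp add: barrier_laplacian_def A_def algebra_simps)
  qed
  then have sum: "(\<Sum>i\<in>UNIV. d2 i) < 0" using neg by simp
  show False
  proof (rule harmonic_norm_le_barrier_contradiction[OF f \<open>M > 0\<close> _ _ sum le eq])
    fix i :: 3 and t
    show "((\<lambda>s. barrier m p (q + s *\<^sub>R axis i 1)) has_real_derivative
       ((1 + A) * (2 * real m + 2) * p $ i * l i t ^ (2 * m + 1)
        - A * (2 * real m * p $ i * l i t ^ (2 * m - 1) * r i t + l i t ^ (2 * m) * (2 * q $ i + 2 * t)))) (at t)"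
      unfolding line by (rule derivative_eq_intros refl)+ (simp add: algebra_simps)
    show "((\<lambda>t. (1 + A) * (2 * real m + 2) * p $ i * l i t ^ (2 * m + 1)
        - A * (2 * real m * p $ i * l i t ^ (2 * m - 1) * r i t + l i t ^ (2 * m) * (2 * q $ i + 2 * t)))
        has_real_derivative d2 i) (at 0)"
    proof -
      have l0: "l i 0 = q \<bullet> p" and r0: "r i 0 = q \<bullet> q" by (simp_all add: l_def r_def)
      have n1: "real (m * 2 - Suc 0) = 2 * real m - 1" if "m \<noteq> 0" using that by (cases m) simp_all
      have n2: "m * 2 - Suc (Suc 0) = m * 2 - 2" by simp
      show ?thesis
        by (rule derivative_eq_intros refl)+ (cases "m = 0"; simp add: n1 n2 l0 r0 d2_def power2_eq_square algebra_simps)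
    qed
  qed
qed

section \<open>Stereographic projection\<close>

text \<open>An orthogonal transformation taking the third basis vector to \<open>c\<close> carries
  the standard basis to the required one.\<close>

lemma frame_exists:
  fixes c :: "real^3"
  assumes "norm c = 1"
  shows "\<exists>a b. a \<bullet> a = 1 \<and> b \<bullet> b = 1 \<and> a \<bullet> b = 0 \<and> a \<bullet> c = 0 \<and> b \<bullet> c = 0 \<and>
           (\<forall>x. x = (x \<bullet> a) *\<^sub>R a + (x \<bullet> b) *\<^sub>R b + (x \<bullet> c) *\<^sub>R c)"
proof -
  have "norm (axis 3 1 :: real^3) = 1" by simp
  then obtain T :: "real^3 \<Rightarrow> real^3" where T: "orthogonal_transformation T" "T (axis 3 1) = c"
    using orthogonal_transformation_exists_1[OF _ assms] by blast
  have lin: "linear T" and inner: "T x \<bullet> T y = x \<bullet> y" for x y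
    using T(1) by (auto simp: orthogonal_transformation_def)
  have "x = (x \<bullet> T (axis 1 1)) *\<^sub>R T (axis 1 1) + (x \<bullet> T (axis 2 1)) *\<^sub>R T (axis 2 1) + (x \<bullet> c) *\<^sub>R c" for x
  proof -
    obtain y where y: "x = T y"
      using orthogonal_transformation_surj[OF T(1)] by (metis surj_def)
    have "y = (y $ 1) *\<^sub>R axis 1 1 + (y $ 2) *\<^sub>R axis 2 1 + (y $ 3) *\<^sub>R axis 3 1"
      by (simp add: vec_eq_iff forall_3 axis_def)
    then have "T y = T ((y $ 1) *\<^sub>R axis 1 1 + (y $ 2) *\<^sub>R axis 2 1 + (y $ 3) *\<^sub>R axis 3 1)"
      by (rule arg_cong)
    also have "\<dots> = (y $ 1) *\<^sub>R T (axis 1 1) + (y $ 2) *\<^sub>R T (axis 2 1) + (y $ 3) *\<^sub>R T (axis 3 1)"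
      using lin by (simp add: linear_add linear_scale)
    finally show ?thesis
      unfolding y T(2)[symmetric] inner by (simp add: inner_axis)
  qed
  moreover have "T (axis 1 1) \<bullet> T (axis 1 1) = 1" "T (axis 2 1) \<bullet> T (axis 2 1) = 1"
      "T (axis 1 1) \<bullet> T (axis 2 1) = 0" "T (axis 1 1) \<bullet> c = 0" "T (axis 2 1) \<bullet> c = 0"
    unfolding T(2)[symmetric] inner by (simp_all add: inner_axis_axis)
  ultimately show ?thesis by blast
qed

text \<open>An orthonormal basis with freely chosen pole \<open>c\<close>, so that projection can
  start from a point where a given function does not vanish.\<close>

locale frame =
  fixes a b c :: "real^3"
  assumes unit [simp]: "a \<bullet> a = 1" "b \<bullet> b = 1" "c \<bullet> c = 1"
    and orth [simp]: "a \<bullet> b = 0" "a \<bullet> c = 0" "b \<bullet> c = 0"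
    and expand: "x = (x \<bullet> a) *\<^sub>R a + (x \<bullet> b) *\<^sub>R b + (x \<bullet> c) *\<^sub>R c"
begin

text \<open>Inverse stereographic projection from \<open>c\<close>, with the denominator \<open>\<bar>w\<bar>\<^sup>2 + 1\<close> cleared.\<close>
definition stereo :: "complex \<Rightarrow> real^3" where
  "stereo w = (2 * Re w) *\<^sub>R a + (2 * Im w) *\<^sub>R b + ((cmod w)\<^sup>2 - 1) *\<^sub>R c"

text \<open>Invariant under positive scaling, hence a function of rays. On the ray of
  \<open>c\<close> the denominator vanishes and the value is the dummy 0.\<close>

definition unstereo :: "real^3 \<Rightarrow> complex" where
  "unstereo x = Complex ((x \<bullet> a) / (norm x - x \<bullet> c)) ((x \<bullet> b) / (norm x - x \<bullet> c))"

lemma orth' [simp]: "b \<bullet> a = 0" "c \<bullet> a = 0" "c \<bullet> b = 0"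
  using orth by (simp_all add: inner_commute)

lemma norm_c [simp]: "norm c = 1"
  by (simp add: norm_eq_1)

lemma stereo_inner [simp]:
  "stereo w \<bullet> a = 2 * Re w" "stereo w \<bullet> b = 2 * Im w" "stereo w \<bullet> c = (cmod w)\<^sup>2 - 1"
  by (simp_all add: stereo_def inner_simps)

lemma inner_self: "x \<bullet> x = (x \<bullet> a)\<^sup>2 + (x \<bullet> b)\<^sup>2 + (x \<bullet> c)\<^sup>2"
proof -
  have "x \<bullet> x = x \<bullet> ((x \<bullet> a) *\<^sub>R a + (x \<bullet> b) *\<^sub>R b + (x \<bullet> c) *\<^sub>R c)"
    using expand[of x] by simp
  then show ?thesis by (simp add: inner_simps power2_eq_square)
qed

lemma norm_stereo [simp]: "norm (stereo w) = (cmod w)\<^sup>2 + 1"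
proof -
  have "(norm (stereo w))\<^sup>2 = ((cmod w)\<^sup>2 + 1)\<^sup>2"
    unfolding power2_norm_eq_inner[of "stereo w"] inner_self stereo_inner cmod_power2
    by (simp add: power2_eq_square algebra_simps)
  then show ?thesis by (simp add: power2_eq_iff_nonneg)
qed

lemma unstereo_stereo [simp]: "unstereo (stereo w) = w"
  by (simp add: unstereo_def complex_eq_iff)

lemma inner_c_less: "x \<noteq> norm x *\<^sub>R c \<Longrightarrow> x \<bullet> c < norm x"
  using norm_cauchy_schwarz_eq[of x c] norm_cauchy_schwarz[of x c] by fastforce

text \<open>With \<open>d = norm x - x \<bullet> c\<close>, the squared norm of the component
  orthogonal to \<open>c\<close> factors as \<open>d * (d + 2 * (x \<bullet> c))\<close>. The
  resulting scalar is positive, so the ray is preserved, which suffices for homogeneous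
  functions.\<close>

lemma stereo_unstereo:
  assumes "x \<bullet> c < norm x"
  shows "stereo (unstereo x) = (2 / (norm x - x \<bullet> c)) *\<^sub>R x"
proof -
  define d where "d = norm x - x \<bullet> c"
  have d: "d > 0" using assms by (simp add: d_def)
  have "(norm x)\<^sup>2 = (x \<bullet> a)\<^sup>2 + (x \<bullet> b)\<^sup>2 + (x \<bullet> c)\<^sup>2"
    unfolding power2_norm_eq_inner by (rule inner_self)
  then have "(x \<bullet> a)\<^sup>2 + (x \<bullet> b)\<^sup>2 = d * (d + 2 * (x \<bullet> c))"
    by (simp add: d_def power2_eq_square algebra_simps)
  moreover have "(cmod (unstereo x))\<^sup>2 = ((x \<bullet> a)\<^sup>2 + (x \<bullet> b)\<^sup>2) / d\<^sup>2"
    by (simp add: unstereo_def cmod_power2 power_divide d_def add_divide_distrib)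
  ultimately have "(cmod (unstereo x))\<^sup>2 = (d + 2 * (x \<bullet> c)) / d"
    using d by (simp add: power2_eq_square)
  then have "(cmod (unstereo x))\<^sup>2 - 1 = 2 / d * (x \<bullet> c)"
    using d by (simp add: field_simps)
  then have "stereo (unstereo x) = (2 / d) *\<^sub>R ((x \<bullet> a) *\<^sub>R a + (x \<bullet> b) *\<^sub>R b + (x \<bullet> c) *\<^sub>R c)"
    by (simp add: stereo_def unstereo_def d_def scaleR_add_right)
  then show ?thesis using expand[of x] by (simp add: d_def)
qed

lemma stereo_continuous [continuous_intros]:
  "continuous_on S f \<Longrightarrow> continuous_on S (\<lambda>x. stereo (f x))"
  unfolding stereo_def by (intro continuous_intros)

lemma unstereo_continuous: "isCont unstereo (stereo w)"
  unfolding unstereo_def complex_eq_iff Complex_eq by (intro continuous_intros) auto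

lemma stereo_polynomial:
  assumes "real_polynomial_function u"
  shows "\<exists>p. \<forall>w. u (stereo w) = poly2 p (Re w) (Im w)"
  using assms
proof induction
  case (linear u)
  interpret bounded_linear u by fact
  show ?case
    \<comment> \<open>The list collects
      \<open>2 * s * u a + 2 * t * u b + (s * s + t * t - 1) * u c\<close> by powers of
      \<open>t\<close>, then of \<open>s\<close>.\<close>
    by (rule exI[of _ "[:[:- u c, 2 * u a, u c:], [:2 * u b:], [:u c:]:]"])
       (unfold stereo_def add scaleR cmod_power2, simp add: power2_eq_square algebra_simps)
next
  case (const k)
  show ?case by (rule exI[of _ "[:[:k:]:]"]) simp
next
  case (add u v)
  then show ?case by (metis poly2_simps(1))
next
  case (mult u v)
  then show ?case by (metis poly2_simps(3))
qed

lemma polynomial_function_stereo: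
  assumes "polynomial_function f"
  obtains p q where "\<And>w. f (stereo w) = Complex (poly2 p (Re w) (Im w)) (poly2 q (Re w) (Im w))"
proof -
  have "real_polynomial_function (\<lambda>x. Re (f x))" "real_polynomial_function (\<lambda>x. Im (f x))"
    using assms bounded_linear_Re bounded_linear_Im by (auto simp: polynomial_function_def o_def)
  then show thesis
    using stereo_polynomial that by (metis complex.collapse)
qed

text \<open>Normalised \<open>stereo\<close> is a bijection from the plane onto the sphere without
  \<open>c\<close>, vanishing of \<open>f\<close> depends only on the ray, and the pole adds at most
  one zero.\<close>

lemma finite_zeros_stereo_iff:
  assumes f: "homogeneous_polynomial n f"
  shows "finite {w. f (stereo w) = 0} \<longleftrightarrow> finite {x \<in> sphere 0 1. f x = 0}"
proof
  assume "finite {w. f (stereo w) = 0}"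
  moreover have "{x \<in> sphere 0 1. f x = 0} - {c} \<subseteq> (\<lambda>w. stereo w /\<^sub>R norm (stereo w)) ` {w. f (stereo w) = 0}"
  proof
    fix x assume x: "x \<in> {x \<in> sphere 0 1. f x = 0} - {c}"
    then have [simp]: "norm x = 1" "f x = 0" by auto
    have lt: "x \<bullet> c < norm x"
      using x by (intro inner_c_less) auto
    note st = stereo_unstereo[OF lt]
    have "f (stereo (unstereo x)) = 0"
      unfolding st by (simp only: homogeneous_polynomial_scale[OF f]) simp
    moreover have "x = stereo (unstereo x) /\<^sub>R norm (stereo (unstereo x))"
      using lt unfolding st by (simp del: norm_stereo)
    ultimately show "x \<in> (\<lambda>w. stereo w /\<^sub>R norm (stereo w)) ` {w. f (stereo w) = 0}" by blast
  qed
  ultimately have "finite ({x \<in> sphere 0 1. f x = 0} - {c})"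
    using finite_surj by blast
  then show "finite {x \<in> sphere 0 1. f x = 0}" by simp
next
  assume fin: "finite {x \<in> sphere 0 1. f x = 0}"
  let ?\<sigma> = "\<lambda>w. stereo w /\<^sub>R norm (stereo w)"
  have pos: "(cmod w)\<^sup>2 + 1 > 0" for w by (simp add: add_nonneg_pos)
  have "inj ?\<sigma>"
  proof (rule injI)
    fix v w assume eq: "?\<sigma> v = ?\<sigma> w"
    have "unstereo (?\<sigma> w) = w" for w
      using pos[of w] by (simp add: unstereo_def complex_eq_iff divide_simps)
    then show "v = w" using eq by metis
  qed
  moreover have "?\<sigma> ` {w. f (stereo w) = 0} \<subseteq> {x \<in> sphere 0 1. f x = 0}"
  proof safe
    fix w assume "f (stereo w) = 0"
    then show "f (?\<sigma> w) = 0" by (simp only: homogeneous_polynomial_scale[OF f]) simp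
    show "?\<sigma> w \<in> sphere 0 1" using pos[of w] by simp
  qed
  ultimately show "finite {w. f (stereo w) = 0}"
    using fin by (meson finite_imageD finite_subset inj_on_subset subset_UNIV)
qed

end

section \<open>Stability of finite zero sets\<close>

context frame
begin

text \<open>The quotient of the squared modulus of \<open>g\<close> by the barrier attains its
  maximum on the compact set \<open>T\<close>. A positive maximum cannot lie where \<open>k\<close>
  vanishes, so it lies in the open region where \<open>k < 0\<close>, and a multiple of the barrier
  touches from above there.\<close>

lemma harmonic_vanishes_on_small_region:
  assumes g: "homogeneous_polynomial (Suc m) g" "\<And>x. laplacian g x = 0"
    and bar: "\<And>w. w \<in> cball z r \<Longrightarrow> barrier m p (stereo w) > 0 \<and> barrier_laplacian m p (stereo w) < 0"
    and k: "continuous_on UNIV k" "\<And>w. k w = 0 \<Longrightarrow> g (stereo w) = 0"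
    and op: "open {w \<in> cball z r. k w < (0 :: real)}"
    and w1: "w1 \<in> cball z r" "k w1 < 0"
  shows "g (stereo w1) = 0"
proof (rule ccontr)
  assume ne: "g (stereo w1) \<noteq> 0"
  define T where "T = {w \<in> cball z r. k w \<le> 0}"
  define F where "F = (\<lambda>w. (cmod (g (stereo w)))\<^sup>2 / barrier m p (stereo w))"
  have "T = cball z r \<inter> {w. k w \<le> 0}" by (auto simp: T_def)
  then have "compact T"
    using k(1) by (auto intro!: compact_Int_closed closed_Collect_le)
  moreover have "continuous_on T F"
    unfolding F_def using bar
    by (intro continuous_intros continuous_on_compose2[OF homogeneous_polynomial_continuous[OF g(1), of UNIV]])
       (force simp: T_def)+
  moreover have w1T: "w1 \<in> T" using w1 by (auto simp: T_def)
  ultimately obtain w0 where w0: "w0 \<in> T" "\<And>w. w \<in> T \<Longrightarrow> F w \<le> F w0"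
    using continuous_attains_sup[of T F] by blast
  define M where "M = F w0"
  have "F w1 > 0" using bar[OF w1(1)] ne by (simp add: F_def)
  then have "M > 0" using w0(2)[OF w1T] by (simp add: M_def)
  have bar0: "barrier m p (stereo w0) > 0" "barrier_laplacian m p (stereo w0) < 0"
    using bar w0(1) by (auto simp: T_def)
  have "g (stereo w0) \<noteq> 0" using \<open>M > 0\<close> by (auto simp: M_def F_def)
  then have w0O: "w0 \<in> {w \<in> cball z r. k w < 0}"
    using k(2)[of w0] w0(1) by (force simp: T_def)
  have le: "(cmod (g (stereo w)))\<^sup>2 \<le> M * barrier m p (stereo w)" if "w \<in> {w \<in> cball z r. k w < 0}" for w
    using w0(2)[of w] bar[of w] that by (simp add: F_def M_def T_def field_simps)
  let ?q = "stereo w0"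
  \<comment> \<open>The inequality is known only over the plane; continuity of
    \<open>unstereo\<close> and homogeneity carry it to a full neighbourhood in space.\<close>
  have "filterlim unstereo (nhds (unstereo ?q)) (nhds ?q)"
    using unstereo_continuous[of w0] by (simp only: isCont_def tendsto_at_iff_tendsto_nhds)
  then have "\<forall>\<^sub>F x in nhds ?q. unstereo x \<in> {w \<in> cball z r. k w < 0}"
    using op w0O topological_tendstoD by fastforce
  moreover have "\<forall>\<^sub>F x in nhds ?q. x \<bullet> c < norm x"
  proof -
    have "((\<lambda>x. norm x - x \<bullet> c) \<longlongrightarrow> norm ?q - ?q \<bullet> c) (nhds ?q)"
      by (intro tendsto_intros filterlim_ident)
    then have "\<forall>\<^sub>F x in nhds ?q. 0 < norm x - x \<bullet> c"
      by (rule order_tendstoD) simp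
    then show ?thesis by eventually_elim simp
  qed
  ultimately have ev: "\<forall>\<^sub>F x in nhds ?q. (cmod (g x))\<^sup>2 \<le> M * barrier m p x"
  proof eventually_elim
    case (elim x)
    define s where "s = (norm x - x \<bullet> c) / 2"
    have s: "s > 0" using elim by (simp add: s_def)
    have x: "x = s *\<^sub>R stereo (unstereo x)"
      using elim by (simp add: stereo_unstereo s_def)
    have "(cmod (g x))\<^sup>2 = s ^ (2 * m + 2) * (cmod (g (stereo (unstereo x))))\<^sup>2"
      using s by (subst x, subst homogeneous_polynomial_scale[OF g(1)])
        (simp add: norm_mult norm_power power_mult_distrib power_add mult_2 power2_eq_square flip: of_real_power)
    also have "\<dots> \<le> s ^ (2 * m + 2) * (M * barrier m p (stereo (unstereo x)))"
      using s le[OF elim(1)] by (intro mult_left_mono) auto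
    also have "\<dots> = M * barrier m p x"
      by (subst (2) x, subst barrier_scale) simp
    finally show ?case .
  qed
  show False
  proof (rule harmonic_le_barrier_contradiction[OF _ g(2) \<open>M > 0\<close> bar0(2) ev])
    show "polynomial_function g" by (rule homogeneous_polynomial_polynomial_function[OF g(1)])
    show "(cmod (g ?q))\<^sup>2 = M * barrier m p ?q" using bar0 by (simp add: M_def F_def)
  qed
qed

text \<open>The squared distance is exactly \<open>4 / ((cmod w)\<^sup>2 + 1)\<close>.\<close>

lemma stereo_direction_near_pole:
  assumes "\<delta> > 0" "cmod w \<ge> 2 / \<delta>"
  shows "dist (stereo w /\<^sub>R norm (stereo w)) c < \<delta>"
proof -
  let ?d = "(cmod w)\<^sup>2 + 1"
  have d: "?d > 0" by (simp add: add_nonneg_pos)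
  have "(dist (stereo w /\<^sub>R norm (stereo w)) c)\<^sup>2 = 4 / ?d"
  proof -
    let ?s = "stereo w /\<^sub>R norm (stereo w)"
    have "norm ?s = 1" using d by simp
    then have "?s \<bullet> ?s = 1" by (simp only: norm_eq_1)
    then have "(dist ?s c)\<^sup>2 = 2 - 2 * (?s \<bullet> c)"
      unfolding dist_norm power2_norm_eq_inner by (simp add: inner_diff_left inner_diff_right inner_commute)
    also have "?s \<bullet> c = ((cmod w)\<^sup>2 - 1) / ?d"
      by (simp add: divide_inverse mult.commute)
    finally show ?thesis using d by (simp add: field_simps)
  qed
  also have "\<dots> < \<delta>\<^sup>2"
  proof -
    have "2 \<le> \<delta> * cmod w" using assms by (simp add: field_simps)
    then have "2\<^sup>2 \<le> (\<delta> * cmod w)\<^sup>2" by (intro power_mono) auto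
    then have "4 \<le> \<delta>\<^sup>2 * (cmod w)\<^sup>2" by (simp add: power_mult_distrib)
    moreover have "\<delta>\<^sup>2 > 0" using assms(1) by simp
    ultimately have "4 < \<delta>\<^sup>2 * ?d"
      unfolding distrib_left by linarith
    then show ?thesis using d by (simp add: field_simps)
  qed
  finally show ?thesis using assms(1) by (simp add: power2_less_imp_less)
qed

text \<open>\<open>K\<close> may be unbounded. Far out the direction is close to \<open>c\<close>,
  where \<open>f\<close> is nonzero; what remains is compact.\<close>

lemma norm_stereo_direction_bounded_below:
  assumes f: "continuous_on UNIV f" "f c \<noteq> 0"
    and K: "closed K" "\<And>w. w \<in> K \<Longrightarrow> f (stereo w /\<^sub>R norm (stereo w)) \<noteq> 0"
  shows "\<exists>\<epsilon>>0. \<forall>w\<in>K. \<epsilon> \<le> cmod (f (stereo w /\<^sub>R norm (stereo w)))"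
proof -
  let ?F = "\<lambda>w. cmod (f (stereo w /\<^sub>R norm (stereo w)))"
  have d: "(cmod w)\<^sup>2 + 1 \<noteq> 0" for w
    by (metis add_nonneg_eq_0_iff zero_le_one zero_le_power2 zero_neq_one)
  have "((\<lambda>x. cmod (f x)) \<longlongrightarrow> cmod (f c)) (nhds c)"
    using f(1) by (intro tendsto_norm) (simp add: continuous_on_eq_continuous_at isCont_def tendsto_at_iff_tendsto_nhds)
  then have "\<forall>\<^sub>F x in nhds c. cmod (f c) / 2 < cmod (f x)"
    by (rule order_tendstoD) (use f(2) in simp)
  then obtain \<delta> where \<delta>: "\<delta> > 0" "\<And>x. dist x c < \<delta> \<Longrightarrow> cmod (f c) / 2 < cmod (f x)"
    by (auto simp: eventually_nhds_metric)
  have far: "cmod (f c) / 2 \<le> ?F w" if "cmod w \<ge> 2 / \<delta>" for w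
    using \<delta>(2)[OF stereo_direction_near_pole[OF \<delta>(1) that]] by simp
  have cont: "continuous_on (K \<inter> cball 0 (2 / \<delta>)) ?F"
    by (intro continuous_intros continuous_on_compose2[OF f(1)]) (use d in auto)
  have "\<exists>\<epsilon>>0. \<forall>w\<in>K \<inter> cball 0 (2 / \<delta>). \<epsilon> \<le> ?F w"
  proof (cases "K \<inter> cball 0 (2 / \<delta>) = {}")
    case True
    then show ?thesis by (intro exI[of _ 1]) auto
  next
    case False
    moreover have "compact (K \<inter> cball 0 (2 / \<delta>))"
      using K(1) by (intro closed_Int_compact compact_cball)
    ultimately obtain w0 where "w0 \<in> K \<inter> cball 0 (2 / \<delta>)" "\<And>w. w \<in> K \<inter> cball 0 (2 / \<delta>) \<Longrightarrow> ?F w0 \<le> ?F w"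
      using continuous_attains_inf[OF _ _ cont] by blast
    then show ?thesis using K(2) by (intro exI[of _ "?F w0"]) auto
  qed
  then obtain \<epsilon> where \<epsilon>: "\<epsilon> > 0" "\<And>w. w \<in> K \<Longrightarrow> cmod w \<le> 2 / \<delta> \<Longrightarrow> \<epsilon> \<le> ?F w"
    by auto
  have "min \<epsilon> (cmod (f c) / 2) \<le> ?F w" if "w \<in> K" for w
    using \<epsilon>(2)[OF that] far[of w] by linarith
  then show ?thesis
    using \<epsilon>(1) f(2) by (intro exI[of _ "min \<epsilon> (cmod (f c) / 2)"]) auto
qed

lemma infinite_zeros_prime_divisor:
  assumes g: "homogeneous_polynomial n g" "infinite {x \<in> sphere 0 1. g x = 0}"
    and pq: "\<And>w. g (stereo w) = Complex (poly2 p (Re w) (Im w)) (poly2 q (Re w) (Im w))"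
    and "p \<noteq> 0 \<or> q \<noteq> 0"
  shows "\<exists>h. prime h \<and> h dvd p \<and> h dvd q \<and> infinite {(s, t). poly2 h s t = 0}"
proof (rule infinite_common_zeros_prime_divisor[OF _ assms(4)])
  have "{w. g (stereo w) = 0} \<subseteq> (\<lambda>(s, t). Complex s t) ` {(s, t). poly2 p s t = 0 \<and> poly2 q s t = 0}"
  proof
    fix w assume "w \<in> {w. g (stereo w) = 0}"
    then have "(Re w, Im w) \<in> {(s, t). poly2 p s t = 0 \<and> poly2 q s t = 0}"
      by (simp add: pq complex_eq_iff)
    then show "w \<in> (\<lambda>(s, t). Complex s t) ` {(s, t). poly2 p s t = 0 \<and> poly2 q s t = 0}"
      by (force intro!: image_eqI[of _ _ "(Re w, Im w)"])
  qed
  then show "infinite {(s, t). poly2 p s t = 0 \<and> poly2 q s t = 0}"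
    using g(2) finite_zeros_stereo_iff[OF g(1)] finite_surj by blast
qed

end

text \<open>Induction with Janiszewski's theorem: two compact sets with connected complements and
  empty intersection have a union with connected complement.\<close>

lemma connected_complement_disjoint_cballs:
  fixes W :: "complex set"
  assumes "finite W" "pairwise (\<lambda>v w. disjnt (cball v r) (cball w r)) W"
  shows "connected (- (\<Union>w\<in>W. cball w r))"
  using assms
proof (induction W)
  case (insert z W)
  have "cball z r \<inter> (\<Union>w\<in>W. cball w r) = {}"
    using insert.hyps insert.prems by (auto simp: pairwise_insert disjnt_def)
  then have "connected (- (cball z r \<union> (\<Union>w\<in>W. cball w r)))"
    using insert by (intro Janiszewski_connected connected_complement_bounded_convex[OF bounded_cball convex_cball] insert.IH)
      (auto simp: pairwise_insert)
  then show ?case by simp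
qed (simp add: connected_UNIV)

lemma infinite_unit_sphere: "infinite (sphere (0 :: real^3) 1)"
proof
  assume "finite (sphere (0 :: real^3) 1)"
  moreover have "connected (sphere (0 :: real^3) 1)"
    by (rule connected_sphere) simp
  ultimately obtain x :: "real^3" where "sphere 0 1 = {x}"
    using connected_finite_iff_sing[of "sphere (0 :: real^3) 1"] by auto
  moreover have "axis 1 1 \<in> sphere (0 :: real^3) 1" "axis 2 1 \<in> sphere (0 :: real^3) 1"
    by simp_all
  ultimately have "axis 1 1 = (axis 2 1 :: real^3)" by (metis singletonD)
  then show False by (simp add: axis_eq_axis)
qed

text \<open>Take \<open>p\<close> as the direction of \<open>stereo z\<close>: both inequalities
  hold on its ray and are open conditions. The form for all small \<open>r\<close> lets finitely
  many discs share one radius.\<close>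

lemma eventually_small_disc_barrier:
  assumes "frame a b c"
  shows "\<exists>p. \<forall>\<^sub>F r in at_right 0. \<forall>w\<in>cball z r.
           barrier m p (frame.stereo a b c w) > 0 \<and> barrier_laplacian m p (frame.stereo a b c w) < 0"
proof -
  interpret frame a b c by fact
  define p where "p = stereo z /\<^sub>R norm (stereo z)"
  have pos: "(cmod z)\<^sup>2 + 1 > 0" by (simp add: add_nonneg_pos)
  then have p: "norm p = 1" "stereo z = ((cmod z)\<^sup>2 + 1) *\<^sub>R p"
    by (simp_all add: p_def)
  define S where "S = {w. barrier m p (stereo w) > 0} \<inter> {w. barrier_laplacian m p (stereo w) < 0}"
  have "open S"
    unfolding S_def by (intro open_Int open_Collect_less continuous_intros continuous_on_id)
  moreover have "z \<in> S"
    using barrier_on_ray[OF p(1) pos, of m] by (simp add: S_def p(2))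
  ultimately obtain e where e: "e > 0" "cball z e \<subseteq> S" using open_contains_cball by blast
  have "\<forall>\<^sub>F r in at_right 0. \<forall>w\<in>cball z r. barrier m p (stereo w) > 0 \<and> barrier_laplacian m p (stereo w) < 0"
    unfolding eventually_at_right_field
  proof (intro exI[of _ e] conjI allI impI ballI e(1))
    fix r w assume "r < e" "w \<in> cball z r"
    then have "w \<in> S" using e(2) by (force simp: subset_iff)
    then show "barrier m p (stereo w) > 0" "barrier_laplacian m p (stereo w) < 0"
      by (auto simp: S_def)
  qed
  then show ?thesis by blast
qed

lemma finite_zeros_stable:
  assumes f: "f \<in> harmonics n" "finite {x \<in> sphere 0 1. f x = 0}"
  shows "\<exists>\<epsilon>>0. \<forall>g\<in>harmonics n. (\<forall>x\<in>sphere 0 1. cmod (f x - g x) < \<epsilon>) \<longrightarrow> finite {x \<in> sphere 0 1. g x = 0}"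
proof (cases n)
  case 0
  \<comment> \<open>Degree 0 is separate because \<open>barrier m\<close> matches degree
    \<open>m + 1\<close>. Scaling by 0 shows that \<open>g\<close> is constant, as
    \<open>0 ^ 0 = 1\<close>.\<close>
  have const: "g x = g 0" if "g \<in> harmonics n" for g x
    using homogeneous_polynomial_scale[of 0 g 0 x] that 0 by (simp add: harmonics_def)
  have "{x \<in> sphere 0 1. f x = 0} \<noteq> sphere 0 1" using f(2) infinite_unit_sphere by metis
  then have "f 0 \<noteq> 0" using const[OF f(1)] by force
  moreover have "finite {x \<in> sphere 0 1. g x = 0}"
    if "g \<in> harmonics n" and close: "\<forall>x\<in>sphere 0 1. cmod (f x - g x) < cmod (f 0)" for g
  proof -
    have "g x \<noteq> 0" if "x \<in> sphere 0 1" for x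
      using close that const[OF f(1), of x] by force
    then have "{x \<in> sphere 0 1. g x = 0} = {}" by blast
    then show ?thesis by (simp only: finite.emptyI)
  qed
  ultimately show ?thesis by (intro exI[of _ "cmod (f 0)"]) auto
next
  case (Suc m)
  \<comment> \<open>The pole is placed off the zeros of \<open>f\<close>, so that \<open>f\<close>
    stays away from 0 at the infinite end of the plane.\<close>
  have "infinite (sphere 0 1 - {x \<in> sphere 0 1. f x = 0})"
    using infinite_unit_sphere f(2) by (rule Diff_infinite_finite[rotated])
  then obtain c where "c \<in> sphere 0 1 - {x \<in> sphere 0 1. f x = 0}"
    using infinite_imp_nonempty by blast
  then have c: "norm c = 1" "f c \<noteq> 0" by auto
  then obtain a b where "frame a b c"
    using frame_exists[OF c(1)] by (auto simp: frame_def norm_eq_1)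
  then interpret frame a b c .
  have hom: "homogeneous_polynomial n f" using f(1) by (simp add: harmonics_def)
  define W where "W = {w. f (stereo w) = 0}"
  have finW: "finite W"
    unfolding W_def using finite_zeros_stereo_iff[OF hom] f(2) by blast
  define p where "p = (\<lambda>z. SOME p. \<forall>\<^sub>F r in at_right 0. \<forall>w\<in>cball z r.
      barrier m p (stereo w) > 0 \<and> barrier_laplacian m p (stereo w) < 0)"
  have p: "\<forall>\<^sub>F r in at_right 0. \<forall>w\<in>cball z r.
      barrier m (p z) (stereo w) > 0 \<and> barrier_laplacian m (p z) (stereo w) < 0" for z
    unfolding p_def by (rule someI_ex) (rule eventually_small_disc_barrier[OF \<open>frame a b c\<close>])
  have "\<forall>\<^sub>F r in at_right 0. v \<noteq> w \<longrightarrow> disjnt (cball v r) (cball w r)" for v w :: complex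
  proof (cases "v = w")
    case False
    have "disjnt (cball v r) (cball w r)" if "r < dist v w / 2" for r
    proof -
      have False if "x \<in> cball v r" "x \<in> cball w r" for x
        using that \<open>r < dist v w / 2\<close> dist_triangle2[of v w x] by (simp add: dist_commute)
      then show ?thesis by (auto simp: disjnt_def)
    qed
    then show ?thesis
      unfolding eventually_at_right_field using False by (intro exI[of _ "dist v w / 2"]) auto
  qed simp
  then have "\<forall>\<^sub>F r in at_right 0. \<forall>v\<in>W. \<forall>w\<in>W. v \<noteq> w \<longrightarrow> disjnt (cball v r) (cball w r)"
    using finW by (intro eventually_ball_finite ballI)
  moreover have "\<forall>\<^sub>F r in at_right 0. \<forall>z\<in>W. \<forall>w\<in>cball z r.
      barrier m (p z) (stereo w) > 0 \<and> barrier_laplacian m (p z) (stereo w) < 0"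
    using p finW by (intro eventually_ball_finite ballI)
  moreover have "\<forall>\<^sub>F r in at_right 0. (r :: real) > 0"
    by (rule eventually_at_right_less)
  ultimately have "\<forall>\<^sub>F r in at_right 0. r > 0 \<and>
      (\<forall>v\<in>W. \<forall>w\<in>W. v \<noteq> w \<longrightarrow> disjnt (cball v r) (cball w r)) \<and>
      (\<forall>z\<in>W. \<forall>w\<in>cball z r. barrier m (p z) (stereo w) > 0 \<and> barrier_laplacian m (p z) (stereo w) < 0)"
    by eventually_elim simp
  from eventually_happens'[OF trivial_limit_at_right_real this]
  obtain r where r: "r > 0"
      and disj: "\<And>v w. v \<in> W \<Longrightarrow> w \<in> W \<Longrightarrow> v \<noteq> w \<Longrightarrow> disjnt (cball v r) (cball w r)"
      and bar: "\<And>z w. z \<in> W \<Longrightarrow> w \<in> cball z r \<Longrightarrow>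
        barrier m (p z) (stereo w) > 0 \<and> barrier_laplacian m (p z) (stereo w) < 0"
    by blast
  \<comment> \<open>Two complements are used: \<open>K\<close>, of the open discs, is closed and
    carries the lower bound for \<open>f\<close>; its subset \<open>C\<close>, of the closed discs,
    is connected.\<close>
  define K where "K = - (\<Union>z\<in>W. ball z r)"
  have "closed K" unfolding K_def by (intro closed_Compl open_UN) auto
  have "bounded (\<Union>z\<in>W. ball z r)" using finW by auto
  then have "(\<Union>z\<in>W. ball z r) \<noteq> UNIV" using not_bounded_UNIV by metis
  then have "K \<noteq> {}" unfolding K_def by blast
  have pos: "(cmod w)\<^sup>2 + 1 > 0" for w by (simp add: add_nonneg_pos)
  have dir: "g (stereo w /\<^sub>R norm (stereo w)) = 0 \<longleftrightarrow> g (stereo w) = 0"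
    if "homogeneous_polynomial n g" for g w
  proof -
    have "inverse (norm (stereo w)) ^ n \<noteq> 0" using pos[of w] by simp
    then show ?thesis
      by (simp only: homogeneous_polynomial_scale[OF that] mult_eq_0_iff of_real_eq_0_iff simp_thms)
  qed
  have "\<exists>\<epsilon>>0. \<forall>w\<in>K. \<epsilon> \<le> cmod (f (stereo w /\<^sub>R norm (stereo w)))"
  proof (rule norm_stereo_direction_bounded_below[OF homogeneous_polynomial_continuous[OF hom] c(2) \<open>closed K\<close>])
    fix w assume "w \<in> K"
    then have "w \<notin> W" using r by (auto simp: K_def)
    then show "f (stereo w /\<^sub>R norm (stereo w)) \<noteq> 0" using dir[OF hom] by (simp add: W_def)
  qed
  then obtain \<epsilon> where \<epsilon>: "\<epsilon> > 0" "\<And>w. w \<in> K \<Longrightarrow> \<epsilon> \<le> cmod (f (stereo w /\<^sub>R norm (stereo w)))"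
    by blast
  have "finite {x \<in> sphere 0 1. g x = 0}"
    if g: "g \<in> harmonics n" and close: "\<forall>x\<in>sphere 0 1. cmod (f x - g x) < \<epsilon>" for g
  proof (rule ccontr)
    assume inf: "infinite {x \<in> sphere 0 1. g x = 0}"
    have homg: "homogeneous_polynomial n g" and lap: "\<And>x. laplacian g x = 0"
      using g by (auto simp: harmonics_def)
    have gK: "g (stereo w) \<noteq> 0" if "w \<in> K" for w
    proof
      assume "g (stereo w) = 0"
      then have "g (stereo w /\<^sub>R norm (stereo w)) = 0" using dir[OF homg] by blast
      moreover have "stereo w /\<^sub>R norm (stereo w) \<in> sphere 0 1" using pos[of w] by simp
      ultimately have "cmod (f (stereo w /\<^sub>R norm (stereo w))) < \<epsilon>"
        using close by (metis diff_zero)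
      then show False using \<epsilon>(2)[OF that] by simp
    qed
    obtain P Q where PQ: "\<And>w. g (stereo w) = Complex (poly2 P (Re w) (Im w)) (poly2 Q (Re w) (Im w))"
      using polynomial_function_stereo[OF homogeneous_polynomial_polynomial_function[OF homg]] by blast
    have "P \<noteq> 0 \<or> Q \<noteq> 0"
      using \<open>K \<noteq> {}\<close> gK PQ by (force simp: complex_eq_iff)
    then obtain h where h: "prime h" "h dvd P" "h dvd Q" "infinite {(s, t). poly2 h s t = 0}"
      using infinite_zeros_prime_divisor[OF homg inf PQ] by blast
    define H where "H = (\<lambda>w. poly2 h (Re w) (Im w))"
    have H0: "g (stereo w) = 0" if "H w = 0" for w
      using h(2,3) that by (auto simp: PQ H_def complex_eq_iff elim!: dvdE)
    have contH: "continuous_on S H" for S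
      unfolding H_def by (intro continuous_intros)
    have sign: "\<exists>w. H w < 0" "\<exists>w. H w > 0"
      using prime_infinite_zeros_sign_change[OF h(1,4)] by (auto simp: H_def) (metis complex.sel)+
    define C where "C = - (\<Union>z\<in>W. cball z r)"
    have "connected C"
      unfolding C_def using disj by (intro connected_complement_disjoint_cballs finW) (auto simp: pairwise_def)
    have HC: "H w \<noteq> 0" if "w \<in> C" for w
    proof -
      have "w \<in> K" using that by (auto simp: C_def K_def)
      then show ?thesis using gK H0 by blast
    qed
    have "(\<forall>w\<in>C. H w > 0) \<or> (\<forall>w\<in>C. H w < 0)"
    proof (rule ccontr)
      assume "\<not> ?thesis"
      then obtain v w where vw: "v \<in> C" "H v \<le> 0" "w \<in> C" "H w \<ge> 0" by (meson not_le)
      have "connected (H ` C)" using contH \<open>connected C\<close> by (rule connected_continuous_image)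
      then have "0 \<in> H ` C" using vw by (meson connectedD_interval imageI)
      then show False using HC by force
    qed
    \<comment> \<open>\<open>k\<close> is \<open>H\<close> or \<open>- H\<close>, with the sign that
      makes it positive off the discs; the sign change of \<open>h\<close> supplies a negative
      value.\<close>
    then obtain k :: "complex \<Rightarrow> real" where k: "continuous_on UNIV k" "\<And>w. k w = 0 \<Longrightarrow> g (stereo w) = 0"
        "\<exists>w. k w < 0" "\<And>w. w \<in> C \<Longrightarrow> k w > 0"
    proof
      assume "\<forall>w\<in>C. H w > 0"
      then show thesis using that[of H] contH H0 sign by blast
    next
      assume "\<forall>w\<in>C. H w < 0"
      then show thesis using that[of "\<lambda>w. - H w"] contH H0 sign by (simp add: continuous_on_minus)
    qed
    obtain w1 where w1: "k w1 < 0" using k(3) by blast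
    then have "w1 \<notin> C" using k(4) by fastforce
    then obtain z where z: "z \<in> W" "w1 \<in> cball z r" by (auto simp: C_def)
    define U where "U = {w \<in> cball z r. k w < 0}"
    \<comment> \<open>Since \<open>k\<close> is positive on \<open>C\<close>, negative values occur
      only in the discs; removing the other closed discs exhibits \<open>U\<close> as open in the
      plane.\<close>
    have "U = {w. k w < 0} \<inter> - (\<Union>v\<in>W - {z}. cball v r)"
    proof (intro equalityI subsetI)
      fix w assume "w \<in> U"
      then show "w \<in> {w. k w < 0} \<inter> - (\<Union>v\<in>W - {z}. cball v r)"
        using disj[OF z(1)] by (fastforce simp: U_def disjnt_def)
    next
      fix w assume w: "w \<in> {w. k w < 0} \<inter> - (\<Union>v\<in>W - {z}. cball v r)"
      then have "w \<notin> C" using k(4) by fastforce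
      then show "w \<in> U" using w by (auto simp: C_def U_def)
    qed
    moreover have "open ({w. k w < 0} \<inter> - (\<Union>v\<in>W - {z}. cball v r))"
      using finW k(1) by (intro open_Int open_Compl closed_UN open_Collect_less) auto
    ultimately have "open U" by simp
    have U0: "g (stereo w) = 0" if "w \<in> U" for w
      using that homg lap bar[OF z(1)] k(1,2) \<open>open U\<close>
      by (intro harmonic_vanishes_on_small_region[of m g z r "p z" k w]) (auto simp: Suc U_def)
    have "w1 \<in> U" using z w1 by (simp add: U_def)
    then obtain e where e: "e > 0" "ball w1 e \<subseteq> U" using \<open>open U\<close> open_contains_ball by blast
    have "poly2 P s t = 0 \<and> poly2 Q s t = 0"
      if "s \<in> {Re w1<..<Re w1 + e / 2}" "t \<in> {Im w1<..<Im w1 + e / 2}" for s t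
    proof -
      have "dist w1 (Complex s t) < e"
        using that cmod_le[of "w1 - Complex s t"] by (simp add: dist_norm)
      then have "Complex s t \<in> U" using e(2) by auto
      from U0[OF this] show ?thesis by (simp add: PQ complex_eq_iff)
    qed
    moreover have "infinite {Re w1<..<Re w1 + e / 2}" "infinite {Im w1<..<Im w1 + e / 2}"
      using e(1) by (intro infinite_Ioo; simp)+
    ultimately have "P = 0" "Q = 0" using poly2_eq_0_on_box by blast+
    then show False using \<open>P \<noteq> 0 \<or> Q \<noteq> 0\<close> by simp
  qed
  then show ?thesis using \<epsilon>(1) by blast
qed

section \<open>Perturbation by sectoral harmonics\<close>

lemma homogeneous_polynomial_lincomb:
  assumes "homogeneous_polynomial n f" "homogeneous_polynomial n g"
  shows "homogeneous_polynomial n (\<lambda>x. f x + k * g x)"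
proof -
  obtain c where c: "\<And>x. f x = (\<Sum>\<alpha> | (\<Sum>i\<in>UNIV. \<alpha> i) = n.
      c \<alpha> * of_real (\<Prod>i\<in>UNIV. x $ i ^ \<alpha> i))"
    using assms(1) unfolding homogeneous_polynomial_def by (elim exE) (rule that, erule spec)
  obtain d where d: "\<And>x. g x = (\<Sum>\<alpha> | (\<Sum>i\<in>UNIV. \<alpha> i) = n.
      d \<alpha> * of_real (\<Prod>i\<in>UNIV. x $ i ^ \<alpha> i))"
    using assms(2) unfolding homogeneous_polynomial_def by (elim exE) (rule that, erule spec)
  show ?thesis
    unfolding homogeneous_polynomial_def c d
    by (intro exI[of _ "\<lambda>\<alpha>. c \<alpha> + k * d \<alpha>"] allI)
       (simp only: sum_distrib_left sum.distrib distrib_right mult.assoc)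
qed

lemma harmonics_lincomb:
  assumes "f \<in> harmonics n" "g \<in> harmonics n"
  shows "(\<lambda>x. f x + k * g x) \<in> harmonics n"
  using assms homogeneous_polynomial_polynomial_function
  unfolding harmonics_def by (auto simp: homogeneous_polynomial_lincomb laplacian_lincomb)

lemma homogeneous_polynomial_mult_coordinate:
  assumes "homogeneous_polynomial n f"
  shows "homogeneous_polynomial (Suc n) (\<lambda>x. of_real (x $ j) * f x)"
proof -
  obtain c where c: "\<And>x. f x = (\<Sum>\<alpha> | (\<Sum>i\<in>UNIV. \<alpha> i) = n.
      c \<alpha> * of_real (\<Prod>i\<in>UNIV. x $ i ^ \<alpha> i))"
    using assms unfolding homogeneous_polynomial_def by (elim exE) (rule that, erule spec)
  define up where "up = (\<lambda>\<alpha> :: 3 \<Rightarrow> nat. \<alpha>(j := Suc (\<alpha> j)))"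
  \<comment> \<open>Multiplication by a coordinate shifts multi-indices by \<open>up\<close>; those
    with \<open>\<alpha> j = 0\<close> lie outside its range and get coefficient 0.\<close>
  define d where "d = (\<lambda>\<alpha> :: 3 \<Rightarrow> nat. if \<alpha> j = 0 then 0 else c (\<alpha>(j := \<alpha> j - 1)))"
  have d_up: "d (up \<alpha>) = c \<alpha>" for \<alpha> by (simp add: d_def up_def)
  have sum_up: "(\<Sum>i\<in>UNIV. up \<alpha> i) = Suc (\<Sum>i\<in>UNIV. \<alpha> i)" for \<alpha>
    by (simp add: up_def sum.remove[of UNIV j])
  have prod_up: "(\<Prod>i\<in>UNIV. x $ i ^ up \<alpha> i) = x $ j * (\<Prod>i\<in>UNIV. x $ i ^ \<alpha> i)" for \<alpha> and x :: "real^3"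
    by (simp add: up_def prod.remove[of UNIV j])
  have inj: "inj_on up A" for A
    by (auto simp: inj_on_def up_def fun_eq_iff split: if_splits)
  have "of_real (x $ j) * f x = (\<Sum>\<alpha> | (\<Sum>i\<in>UNIV. \<alpha> i) = Suc n. d \<alpha> * of_real (\<Prod>i\<in>UNIV. x $ i ^ \<alpha> i))" for x
  proof -
    have "of_real (x $ j) * f x = (\<Sum>\<alpha> | (\<Sum>i\<in>UNIV. \<alpha> i) = n. d (up \<alpha>) * of_real (\<Prod>i\<in>UNIV. x $ i ^ up \<alpha> i))"
      unfolding c d_up prod_up sum_distrib_left
      by (intro sum.cong refl) (simp only: of_real_mult mult_ac)
    also have "\<dots> = (\<Sum>\<alpha>\<in>up ` {\<alpha>. (\<Sum>i\<in>UNIV. \<alpha> i) = n}. d \<alpha> * of_real (\<Prod>i\<in>UNIV. x $ i ^ \<alpha> i))"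
      by (simp only: sum.reindex[OF inj] o_def)
    also have "\<dots> = (\<Sum>\<alpha> | (\<Sum>i\<in>UNIV. \<alpha> i) = Suc n. d \<alpha> * of_real (\<Prod>i\<in>UNIV. x $ i ^ \<alpha> i))"
    proof (rule sum.mono_neutral_left[OF finite_multi_indices])
      show "up ` {\<alpha>. (\<Sum>i\<in>UNIV. \<alpha> i) = n} \<subseteq> {\<alpha>. (\<Sum>i\<in>UNIV. \<alpha> i) = Suc n}"
        using sum_up by auto
      show "\<forall>\<alpha>\<in>{\<alpha>. (\<Sum>i\<in>UNIV. \<alpha> i) = Suc n} - up ` {\<alpha>. (\<Sum>i\<in>UNIV. \<alpha> i) = n}.
              d \<alpha> * of_real (\<Prod>i\<in>UNIV. x $ i ^ \<alpha> i) = 0"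
      proof
        fix \<alpha> assume \<alpha>: "\<alpha> \<in> {\<alpha>. (\<Sum>i\<in>UNIV. \<alpha> i) = Suc n} - up ` {\<alpha>. (\<Sum>i\<in>UNIV. \<alpha> i) = n}"
        have "\<alpha> j = 0"
        proof (rule ccontr)
          assume "\<alpha> j \<noteq> 0"
          then have "\<alpha> = up (\<alpha>(j := \<alpha> j - 1))" by (simp add: up_def)
          then show False using \<alpha> sum_up[of "\<alpha>(j := \<alpha> j - 1)"] by auto
        qed
        then show "d \<alpha> * of_real (\<Prod>i\<in>UNIV. x $ i ^ \<alpha> i) = 0" by (simp add: d_def)
      qed
    qed
    finally show ?thesis .
  qed
  then show ?thesis unfolding homogeneous_polynomial_def by blast
qed

text \<open>The highest-weight spherical harmonic, up to normalisation. On the sphere it can vanish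
  only at the two poles on the third axis.\<close>

definition sectoral :: "nat \<Rightarrow> real^3 \<Rightarrow> complex" where
  "sectoral n x = (of_real (x $ 1) + \<i> * of_real (x $ 2)) ^ n"

lemma homogeneous_polynomial_sectoral: "homogeneous_polynomial n (sectoral n)"
proof (induction n)
  case 0
  have "{\<alpha> :: 3 \<Rightarrow> nat. (\<Sum>i\<in>UNIV. \<alpha> i) = 0} = {\<lambda>_. 0}"
    by (auto simp: sum_eq_0_iff)
  then show ?case
    unfolding homogeneous_polynomial_def
    by (intro exI[of _ "\<lambda>_. 1"]) (simp only: sectoral_def sum.insert finite.emptyI, simp)
next
  case (Suc n)
  have "sectoral (Suc n) = (\<lambda>x. of_real (x $ 1) * sectoral n x + \<i> * (of_real (x $ 2) * sectoral n x))"
    by (simp add: fun_eq_iff sectoral_def algebra_simps)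
  then show ?case
    using Suc by (simp only:) (intro homogeneous_polynomial_lincomb homogeneous_polynomial_mult_coordinate)
qed

lemma laplacian_sectoral: "laplacian (sectoral n) x = 0"
proof -
  \<comment> \<open>\<open>\<kappa> i\<close> is the derivative of the base
    \<open>x $ 1 + \<i> * x $ 2\<close> along axis \<open>i\<close>. The Laplacian vanishes because
    the squares of these numbers are 1, -1 and 0.\<close>
  define \<kappa> :: "3 \<Rightarrow> complex" where "\<kappa> = (\<lambda>i. if i = 1 then 1 else if i = 2 then \<i> else 0)"
  have deriv: "partial_deriv i (\<lambda>x. k * sectoral m x) = (\<lambda>x. (k * of_nat m * \<kappa> i) * sectoral (m - 1) x)" for i k m
  proof
    fix x :: "real^3"
    let ?z = "complex_of_real (x $ 1) + \<i> * of_real (x $ 2)"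
    have line: "sectoral m (x + s *\<^sub>R axis i 1) = (?z + of_real s * \<kappa> i) ^ m" for s
      by (auto simp: sectoral_def \<kappa>_def axis_def algebra_simps)
    have "((\<lambda>s. k * (?z + s * \<kappa> i) ^ m) has_field_derivative k * of_nat m * \<kappa> i * ?z ^ (m - 1)) (at (of_real 0))"
      by (auto intro!: derivative_eq_intros)
    then have "((\<lambda>s. k * (?z + of_real s * \<kappa> i) ^ m) has_vector_derivative k * of_nat m * \<kappa> i * ?z ^ (m - 1)) (at 0)"
      by (rule has_vector_derivative_real_field)
    then have "((\<lambda>s. k * sectoral m (x + s *\<^sub>R axis i 1)) has_vector_derivative k * of_nat m * \<kappa> i * ?z ^ (m - 1)) (at 0)"
      by (simp only: line)
    from partial_deriv_eqI[of "\<lambda>x. k * sectoral m x", OF this]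
    show "partial_deriv i (\<lambda>x. k * sectoral m x) x = (k * of_nat m * \<kappa> i) * sectoral (m - 1) x"
      by (simp add: sectoral_def)
  qed
  have "partial_deriv i (sectoral n) = (\<lambda>x. (of_nat n * \<kappa> i) * sectoral (n - 1) x)" for i
    using deriv[of i 1 n] by simp
  then show ?thesis
    unfolding laplacian_def by (simp only: deriv sum_3) (simp add: \<kappa>_def mult_ac)
qed

lemma sectoral_harmonic: "sectoral n \<in> harmonics n"
  by (simp add: harmonics_def homogeneous_polynomial_sectoral laplacian_sectoral)

lemma finite_zeros_sectoral: "finite {x \<in> sphere 0 1. sectoral n x = 0}"
proof (rule finite_subset)
  show "{x \<in> sphere 0 1. sectoral n x = 0} \<subseteq> {axis 3 1, - axis 3 1}"
  proof
    fix x assume "x \<in> {x \<in> sphere 0 1. sectoral n x = 0}"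
    then have "norm x = 1" "complex_of_real (x $ 1) + \<i> * of_real (x $ 2) = 0"
      by (auto simp: sectoral_def)
    then have x: "norm x = 1" "x $ 1 = 0" "x $ 2 = 0"
      by (auto simp: complex_eq_iff)
    then have "(x $ 3)\<^sup>2 = 1"
      unfolding norm_eq_1 by (simp add: inner_vec_def sum_3 power2_eq_square)
    then have "x $ 3 = 1 \<or> x $ 3 = -1" by (simp add: power2_eq_1_iff)
    then show "x \<in> {axis 3 1, - axis 3 1}"
      using x by (auto simp: vec_eq_iff forall_3 axis_def)
  qed
qed simp

text \<open>A prime common divisor for the parameter \<open>\<lambda>\<close> divides \<open>p q' - q p'\<close>, which does not depend on \<open>\<lambda>\<close>.\<close>
lemma finite_bad_pencil_parameters:
  assumes fin: "finite {(s, t). poly2 p' s t = 0 \<and> poly2 q' s t = 0}"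
    and W: "p * q' - q * p' \<noteq> 0"
  shows "finite {k. infinite {(s, t). poly2 (p + [:[:k:]:] * p') s t = 0 \<and> poly2 (q + [:[:k:]:] * q') s t = 0}}"
    (is "finite ?B")
proof -
  define good where "good = (\<lambda>k h. prime h \<and> h dvd p + [:[:k:]:] * p' \<and> h dvd q + [:[:k:]:] * q' \<and>
      infinite {(s, t). poly2 h s t = 0})"
  define h where "h = (\<lambda>k. SOME h. good k h)"
  have good: "good k (h k)" if "k \<in> ?B" for k
  proof -
    have eq: "p * q' - q * p' = (p + [:[:k:]:] * p') * q' - (q + [:[:k:]:] * q') * p'"
      by (simp add: algebra_simps)
    \<comment> \<open>If both members of the pencil were zero, \<open>eq\<close> would make the
      determinant zero.\<close>
    have "p + [:[:k:]:] * p' \<noteq> 0 \<or> q + [:[:k:]:] * q' \<noteq> 0"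
      using W unfolding eq by (metis diff_self mult_zero_left)
    then have "\<exists>h. good k h"
      unfolding good_def using that by (intro infinite_common_zeros_prime_divisor) simp_all
    then show ?thesis unfolding h_def by (rule someI_ex)
  qed
  have "h ` ?B \<subseteq> prime_factors (p * q' - q * p')"
  proof
    fix r assume "r \<in> h ` ?B"
    then obtain k where k: "good k r" using good by blast
    have "p * q' - q * p' = (p + [:[:k:]:] * p') * q' - (q + [:[:k:]:] * q') * p'"
      by (simp add: algebra_simps)
    then have "r dvd p * q' - q * p'" using k by (simp add: good_def)
    then show "r \<in> prime_factors (p * q' - q * p')"
      using k W by (simp add: good_def in_prime_factors_iff)
  qed
  then have "finite (h ` ?B)" using finite_subset by blast
  \<comment> \<open>At a zero of a prime serving two parameters, subtraction gives a common zero of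
    \<open>p'\<close> and \<open>q'\<close>; there are only finitely many of those.\<close>
  moreover have "inj_on h ?B"
  proof (rule inj_onI, rule ccontr)
    fix k l assume kl: "k \<in> ?B" "l \<in> ?B" "h k = h l" "k \<noteq> l"
    define r where "r = h k"
    have r: "good k r" "good l r" using good[OF kl(1)] good[OF kl(2)] kl(3) by (simp_all only: r_def)
    have "{(s, t). poly2 r s t = 0} \<subseteq> {(s, t). poly2 p' s t = 0 \<and> poly2 q' s t = 0}"
    proof (clarify, intro conjI)
      fix s t assume "poly2 r s t = 0"
      then have zero: "poly2 f s t = 0" if "r dvd f" for f
        using that by (auto elim!: dvdE)
      have "poly2 p s t + k * poly2 p' s t = 0" "poly2 p s t + l * poly2 p' s t = 0"
           "poly2 q s t + k * poly2 q' s t = 0" "poly2 q s t + l * poly2 q' s t = 0"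
        using zero[of "p + [:[:k:]:] * p'"] zero[of "p + [:[:l:]:] * p'"]
          zero[of "q + [:[:k:]:] * q'"] zero[of "q + [:[:l:]:] * q'"] r
        unfolding good_def poly2_simps by auto
      then have "(k - l) * poly2 p' s t = 0" "(k - l) * poly2 q' s t = 0"
        unfolding left_diff_distrib by linarith+
      then show "poly2 p' s t = 0" "poly2 q' s t = 0" using kl(4) by simp_all
    qed
    then show False using r(1) fin finite_subset unfolding good_def by blast
  qed
  ultimately show ?thesis by (rule finite_imageD)
qed

text \<open>Let \<open>F\<close> and \<open>G\<close> be the complex polynomials with parts
  \<open>p\<close>, \<open>q\<close> and \<open>p'\<close>, \<open>q'\<close>. The determinants for
  perturbation by \<open>G\<close> and by \<open>\<i> * G\<close> are the imaginary and real parts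
  of \<open>cnj F * G\<close>. They cannot both vanish if \<open>F\<close> and \<open>G\<close> are
  nonzero, so one direction admits the pencil argument.\<close>

lemma exists_small_finite_zeros:
  assumes f: "f \<in> harmonics n" and "\<epsilon> > 0"
  shows "\<exists>k. cmod k < \<epsilon> \<and> finite {x \<in> sphere 0 1. f x + k * sectoral n x = 0}"
proof -
  obtain a b where "frame a b (axis 3 1)"
    using frame_exists[of "axis 3 1"] by (auto simp: frame_def)
  then interpret frame a b "axis 3 1" .
  have hom: "homogeneous_polynomial n f" using f by (simp add: harmonics_def)
  have hom': "homogeneous_polynomial n (\<lambda>x. f x + k * sectoral n x)" for k
    by (intro homogeneous_polynomial_lincomb hom homogeneous_polynomial_sectoral)
  obtain p q where pq: "\<And>w. f (stereo w) = Complex (poly2 p (Re w) (Im w)) (poly2 q (Re w) (Im w))"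
    using polynomial_function_stereo[OF homogeneous_polynomial_polynomial_function[OF hom]] by blast
  obtain p' q' where pq': "\<And>w. sectoral n (stereo w) = Complex (poly2 p' (Re w) (Im w)) (poly2 q' (Re w) (Im w))"
    using polynomial_function_stereo[OF homogeneous_polynomial_polynomial_function[OF homogeneous_polynomial_sectoral]] by blast
  let ?Z = "\<lambda>p q. {(s, t). poly2 p s t = 0 \<and> poly2 q s t = 0}"
  have transfer: "finite {x \<in> sphere 0 1. g x = 0} \<longleftrightarrow> finite (?Z u v)"
    if "homogeneous_polynomial n g"
      "\<And>w. g (stereo w) = Complex (poly2 u (Re w) (Im w)) (poly2 v (Re w) (Im w))" for g u v
  proof -
    have "bij_betw (\<lambda>w. (Re w, Im w)) {w. g (stereo w) = 0} (?Z u v)"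
      by (rule bij_betwI[of _ _ _ "\<lambda>(s, t). Complex s t"]) (auto simp: that(2) complex_eq_iff)
    then show ?thesis
      using finite_zeros_stereo_iff[OF that(1)] bij_betw_finite by blast
  qed
  have fin: "finite (?Z p' q')"
    using transfer[OF homogeneous_polynomial_sectoral pq'] finite_zeros_sectoral by blast
  show ?thesis
  proof (cases "p = 0 \<and> q = 0")
    case True
    have "finite (?Z ([:[:\<epsilon> / 2:]:] * p') ([:[:\<epsilon> / 2:]:] * q'))"
      using fin \<open>\<epsilon> > 0\<close> by (simp only: poly2_simps) simp
    moreover have "f (stereo w) + of_real (\<epsilon> / 2) * sectoral n (stereo w) =
        Complex (poly2 ([:[:\<epsilon> / 2:]:] * p') (Re w) (Im w)) (poly2 ([:[:\<epsilon> / 2:]:] * q') (Re w) (Im w))" for w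
      unfolding pq pq' poly2_simps using True by (simp add: complex_eq_iff)
    ultimately have "finite {x \<in> sphere 0 1. f x + of_real (\<epsilon> / 2) * sectoral n x = 0}"
      using transfer[OF hom'] by blast
    then show ?thesis using \<open>\<epsilon> > 0\<close> by (intro exI[of _ "of_real (\<epsilon> / 2)"]) auto
  next
    case False
    have main: ?thesis
      if W: "p * v - q * u \<noteq> 0" and fin: "finite (?Z u v)" and "cmod \<omega> = 1"
        and uv: "\<And>w. \<omega> * sectoral n (stereo w) = Complex (poly2 u (Re w) (Im w)) (poly2 v (Re w) (Im w))" for u v \<omega>
    proof -
      define B where "B = {k. infinite (?Z (p + [:[:k:]:] * u) (q + [:[:k:]:] * v))}"
      have "infinite ({0<..<\<epsilon>} - B)"
        using finite_bad_pencil_parameters[OF fin W] infinite_Ioo[OF \<open>\<epsilon> > 0\<close>]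
        unfolding B_def by (rule Diff_infinite_finite)
      then obtain k where "k \<in> {0<..<\<epsilon>} - B"
        using infinite_imp_nonempty by blast
      then have k: "0 < k" "k < \<epsilon>" "finite (?Z (p + [:[:k:]:] * u) (q + [:[:k:]:] * v))"
        by (simp_all only: B_def) (simp_all only: Diff_iff greaterThanLessThan_iff mem_Collect_eq not_not)
      have "f (stereo w) + (of_real k * \<omega>) * sectoral n (stereo w) =
        Complex (poly2 (p + [:[:k:]:] * u) (Re w) (Im w)) (poly2 (q + [:[:k:]:] * v) (Re w) (Im w))" for w
        unfolding pq mult.assoc uv poly2_simps by (simp add: complex_eq_iff)
      then have "finite {x \<in> sphere 0 1. f x + (of_real k * \<omega>) * sectoral n x = 0}"
        using transfer[OF hom'] k(3) by blast
      then show ?thesis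
        using k \<open>cmod \<omega> = 1\<close> by (intro exI[of _ "of_real k * \<omega>"]) (simp add: norm_mult)
    qed
    show ?thesis
    proof (cases "p * q' - q * p' = 0")
      case False
      then show ?thesis using main[of q' p' 1] fin pq' by simp
    next
      case True
      have "p * p' + q * q' \<noteq> 0"
      proof
        assume *: "p * p' + q * q' = 0"
        have "p' \<noteq> 0 \<or> q' \<noteq> 0"
        proof (rule ccontr)
          assume "\<not> ?thesis"
          then have "?Z p' q' = UNIV" by auto
          then show False using fin infinite_UNIV_char_0[where 'a = real] by (simp add: finite_prod)
        qed
        then obtain s t where "poly2 p' s t \<noteq> 0 \<or> poly2 q' s t \<noteq> 0"
          using poly2_eq_0_on_box[of UNIV UNIV] infinite_UNIV_char_0 by metis
        then have "poly2 (p' * p' + q' * q') s t \<noteq> 0"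
          by (simp add: sum_squares_eq_zero_iff)
        then have ne: "p' * p' + q' * q' \<noteq> 0" by auto
        \<comment> \<open>\<open>F\<close> times the squared modulus of \<open>G\<close> is
          recovered from the two determinants.\<close>
        have "p * (p' * p' + q' * q') = p' * (p * p' + q * q') + q' * (p * q' - q * p')"
          "q * (p' * p' + q' * q') = q' * (p * p' + q * q') - p' * (p * q' - q * p')"
          by (simp_all add: algebra_simps)
        then show False using * True ne \<open>\<not> (p = 0 \<and> q = 0)\<close> by auto
      qed
      then have "p * p' - q * (- q') \<noteq> 0" by simp
      moreover have neg: "poly2 (- q') s t = - poly2 q' s t" for s t
        using poly2_simps(2)[of 0 q' s t] by simp
      moreover have "?Z (- q') p' = ?Z p' q'" unfolding neg by auto
      ultimately show ?thesis
        using main[of p' "- q'" \<i>] fin by (simp add: neg pq' complex_eq_iff)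
    qed
  qed
qed

section \<open>Closedness and empty interior in the supremum metric\<close>

lemma infinite_common_nodal_set_eq:
  "infinite_common_nodal_set n = {f \<in> harmonics n. infinite {x \<in> sphere 0 1. f x = 0}}"
proof -
  have "nodal_set (\<lambda>x. Re (f x)) \<inter> nodal_set (\<lambda>x. Im (f x)) = {x \<in> sphere 0 1. f x = 0}" for f
    by (auto simp: nodal_set_def complex_eq_iff)
  then show ?thesis by (simp only: infinite_common_nodal_set_def)
qed

text \<open>By compactness of the sphere, \<open>SUP\<close> in \<open>harmonics_dist\<close> is
  taken over a bounded set and has its usual meaning.\<close>

lemma bdd_above_harmonic_diff:
  assumes "f \<in> harmonics n" "g \<in> harmonics n"
  shows "bdd_above ((\<lambda>x. norm (f x - g x)) ` sphere 0 1)"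
  using assms unfolding harmonics_def
  by (intro bounded_imp_bdd_above compact_imp_bounded compact_continuous_image
      continuous_intros homogeneous_polynomial_continuous[of n]) auto

lemma norm_diff_le_harmonics_dist:
  assumes "f \<in> harmonics n" "g \<in> harmonics n" "x \<in> sphere 0 1"
  shows "norm (f x - g x) \<le> harmonics_dist n f g"
  using cSUP_upper[OF assms(3) bdd_above_harmonic_diff[OF assms(1,2)]] assms by (simp add: harmonics_dist_def)

lemma harmonics_dist_le:
  assumes "f \<in> harmonics n" "g \<in> harmonics n" "\<And>x. x \<in> sphere 0 1 \<Longrightarrow> norm (f x - g x) \<le> B"
  shows "harmonics_dist n f g \<le> B"
proof -
  have "sphere (0 :: real^3) 1 \<noteq> {}" by simp
  then have "(SUP x\<in>sphere 0 1. norm (f x - g x)) \<le> B"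
    using assms(3) by (rule cSUP_least)
  then show ?thesis using assms(1,2) by (simp add: harmonics_dist_def)
qed

lemma norm_sectoral_le_1:
  assumes "x \<in> sphere 0 1"
  shows "cmod (sectoral n x) \<le> 1"
proof -
  have "(x $ 1)\<^sup>2 + (x $ 2)\<^sup>2 + (x $ 3)\<^sup>2 = 1"
    using assms by (simp add: norm_eq_1 inner_vec_def sum_3 power2_eq_square)
  then have "(x $ 1)\<^sup>2 + (x $ 2)\<^sup>2 \<le> 1" using zero_le_power2[of "x $ 3"] by linarith
  then have "cmod (of_real (x $ 1) + \<i> * of_real (x $ 2)) \<le> 1"
    by (simp add: cmod_def)
  then show ?thesis by (simp add: sectoral_def norm_power power_le_one)
qed

theorem proposition4:
  fixes n :: nat
  shows "closedin (harmonics_topology n) (infinite_common_nodal_set n) \<and>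
         nowhere_dense_in (harmonics_topology n) (infinite_common_nodal_set n)"
proof -
  interpret Metric_space "harmonics n" "harmonics_dist n"
    by (rule Metric_space_harmonics)
  let ?I = "infinite_common_nodal_set n"
  have sub: "?I \<subseteq> harmonics n" by (auto simp: infinite_common_nodal_set_def)
  have "\<exists>r>0. disjnt ?I (mball f r)" if f: "f \<in> harmonics n - ?I" for f
  proof -
    have fH: "f \<in> harmonics n" and "finite {x \<in> sphere 0 1. f x = 0}"
      using f by (auto simp: infinite_common_nodal_set_eq)
    from finite_zeros_stable[OF this] obtain \<epsilon> where \<epsilon>: "\<epsilon> > 0" "\<And>g. g \<in> harmonics n \<Longrightarrow>
        \<forall>x\<in>sphere 0 1. cmod (f x - g x) < \<epsilon> \<Longrightarrow> finite {x \<in> sphere 0 1. g x = 0}"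
      by blast
    have "g \<notin> ?I" if "g \<in> mball f \<epsilon>" for g
    proof -
      have g: "g \<in> harmonics n" "harmonics_dist n f g < \<epsilon>" using that by auto
      have "\<forall>x\<in>sphere 0 1. cmod (f x - g x) < \<epsilon>"
        using norm_diff_le_harmonics_dist[OF fH g(1)] g(2) order_le_less_trans by blast
      then show ?thesis using \<epsilon>(2)[OF g(1)] by (simp add: infinite_common_nodal_set_eq)
    qed
    then show ?thesis using \<epsilon>(1) unfolding disjnt_def by blast
  qed
  then have closed: "closedin mtopology ?I"
    unfolding closedin_metric using sub by blast
  have "mtopology interior_of ?I = {}"
  proof (rule ccontr)
    assume "mtopology interior_of ?I \<noteq> {}"
    then obtain f where "f \<in> mtopology interior_of ?I" by blast
    moreover have "openin mtopology (mtopology interior_of ?I)" by simp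
    ultimately obtain r where r: "r > 0" "mball f r \<subseteq> mtopology interior_of ?I" and f: "f \<in> harmonics n"
      unfolding openin_mtopology by blast
    \<comment> \<open>As \<open>sectoral n\<close> has modulus at most 1 on the sphere, the bound
      \<open>r / 2\<close> keeps the perturbed function strictly inside the ball.\<close>
    obtain k where k: "cmod k < r / 2" "finite {x \<in> sphere 0 1. f x + k * sectoral n x = 0}"
      using exists_small_finite_zeros[OF f, of "r / 2"] r(1) by auto
    define g where "g = (\<lambda>x. f x + k * sectoral n x)"
    have g: "g \<in> harmonics n"
      unfolding g_def by (intro harmonics_lincomb f sectoral_harmonic)
    have "harmonics_dist n f g \<le> r / 2"
    proof (rule harmonics_dist_le[OF f g])
      fix x :: "real^3" assume "x \<in> sphere 0 1"
      then have "cmod k * cmod (sectoral n x) \<le> cmod k"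
        using norm_sectoral_le_1 by (simp add: mult_left_le)
      then show "cmod (f x - g x) \<le> r / 2" using k(1) by (simp add: g_def norm_mult)
    qed
    then have "g \<in> mball f r" using f g r(1) by simp
    then have "g \<in> ?I" by (rule subsetD[OF subset_trans[OF r(2) interior_of_subset]])
    then show False using k(2) by (simp add: infinite_common_nodal_set_eq g_def)
  qed
  then show ?thesis
    using closed sub by (simp add: harmonics_topology_def nowhere_dense_in_def closure_of_closedin)
qed

end
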